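(* Let $R$ be a regular local ring. Then every finitely generated maximal Cohen--Macaulay module over $R$ is free.
   Context: A regular local ring is a Noetherian commutative local ring $(R,\mathfrak{m})$ such that the minimal number of generators of $\mathfrak{m}$ equals the Krull dimension $\dim(R)$. For a module $M$ over a local ring $(R,\mathfrak{m})$, $\operatorname{depth}(M)\in\mathbb{N}\cup\{\infty\}$ is the least $i$ with $\operatorname{Ext}^i_R(R/\mathfrak{m},M)\ne 0$ (and $\infty$ if there is none). A module $M$ over a local ring $R$ is a maximal Cohen--Macaulay module if $\operatorname{depth}(M)=\dim(R)$. *)

theory Defs
  imports "HOL-Algebra.Module" "HOL-Algebra.QuotRing" "HOL-Algebra.Ring_Divisibility"
    "HOL-Library.Extended_Nat"
begin

section \<open>Regular local rings\<close>

definition local_ring :: "('a, 'b) ring_scheme \<Rightarrow> bool" where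
  "local_ring R \<longleftrightarrow> cring R \<and> (\<exists>!\<mm>. maximalideal \<mm> R)"

text \<open>Meaningful only for local rings.\<close>

definition the_maximal_ideal :: "('a, 'b) ring_scheme \<Rightarrow> 'a set" where
  "the_maximal_ideal R = (THE \<mm>. maximalideal \<mm> R)"

text \<open>Supremum of the lengths \<open>n\<close> of strict chains \<open>P 0 \<subset> P 1 \<subset> \<dots> \<subset> P n\<close> of prime ideals.
  (The zero ring would get dimension \<open>0\<close>, but it is not local.)\<close>

definition krull_dim :: "('a, 'b) ring_scheme \<Rightarrow> enat" where
  "krull_dim R = Sup {enat n | n.
     \<exists>P :: nat \<Rightarrow> 'a set. (\<forall>i\<le>n. primeideal (P i) R) \<and> (\<forall>i<n. P i \<subset> P (Suc i))}"

text \<open>Minimal number of generators of an ideal, \<open>\<infinity>\<close> if it is not finitely generated.\<close>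

definition min_generators :: "('a, 'b) ring_scheme \<Rightarrow> 'a set \<Rightarrow> enat" where
  "min_generators R I = Inf {enat (card A) | A.
     finite A \<and> A \<subseteq> carrier R \<and> genideal R A = I}"

definition regular_local_ring :: "('a, 'b) ring_scheme \<Rightarrow> bool" where
  "regular_local_ring R \<longleftrightarrow>
     local_ring R \<and> noetherian_ring R \<and> min_generators R (the_maximal_ideal R) = krull_dim R"


section \<open>Modules\<close>

definition module_span ::
    "('a, 'b) ring_scheme \<Rightarrow> ('a, 'm, 'c) module_scheme \<Rightarrow> 'm set \<Rightarrow> 'm set" where
  "module_span R M A = \<Inter> {H. submodule H R M \<and> A \<subseteq> H}"

definition finitely_generated_module ::
    "('a, 'b) ring_scheme \<Rightarrow> ('a, 'm, 'c) module_scheme \<Rightarrow> bool" where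
  "finitely_generated_module R M \<longleftrightarrow>
     module R M \<and> (\<exists>A. finite A \<and> A \<subseteq> carrier M \<and> module_span R M A = carrier M)"

definition linearly_independent ::
    "('a, 'b) ring_scheme \<Rightarrow> ('a, 'm, 'c) module_scheme \<Rightarrow> 'm set \<Rightarrow> bool" where
  "linearly_independent R M B \<longleftrightarrow>
     (\<forall>A c. finite A \<and> A \<subseteq> B \<and> c \<in> A \<rightarrow> carrier R \<and>
        (\<Oplus>\<^bsub>M\<^esub>b\<in>A. c b \<odot>\<^bsub>M\<^esub> b) = \<zero>\<^bsub>M\<^esub> \<longrightarrow> (\<forall>b\<in>A. c b = \<zero>\<^bsub>R\<^esub>))"

definition free_module ::
    "('a, 'b) ring_scheme \<Rightarrow> ('a, 'm, 'c) module_scheme \<Rightarrow> bool" where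
  "free_module R M \<longleftrightarrow> module R M \<and>
     (\<exists>B \<subseteq> carrier M. module_span R M B = carrier M \<and> linearly_independent R M B)"

text \<open>Homomorphisms are taken extensional (\<open>undefined\<close> off the carrier), so that equality of
  functions is equality of homomorphisms.\<close>

definition mod_hom :: "('a, 'b) ring_scheme \<Rightarrow> ('a, 'm, 'c) module_scheme \<Rightarrow>
    ('a, 'n, 'd) module_scheme \<Rightarrow> ('m \<Rightarrow> 'n) set" where
  "mod_hom R M N = {h \<in> carrier M \<rightarrow>\<^sub>E carrier N.
     (\<forall>x\<in>carrier M. \<forall>y\<in>carrier M. h (x \<oplus>\<^bsub>M\<^esub> y) = h x \<oplus>\<^bsub>N\<^esub> h y) \<and>
     (\<forall>r\<in>carrier R. \<forall>x\<in>carrier M. h (r \<odot>\<^bsub>M\<^esub> x) = r \<odot>\<^bsub>N\<^esub> h x)}"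

definition module_ker :: "('m, 'c) ring_scheme \<Rightarrow> ('n, 'd) ring_scheme \<Rightarrow> ('m \<Rightarrow> 'n) \<Rightarrow> 'm set" where
  "module_ker M N h = {x \<in> carrier M. h x = \<zero>\<^bsub>N\<^esub>}"

definition Hom_group :: "('a, 'b) ring_scheme \<Rightarrow> ('a, 'm, 'c) module_scheme \<Rightarrow>
    ('a, 'n, 'd) module_scheme \<Rightarrow> ('m \<Rightarrow> 'n) monoid" where
  "Hom_group R M N =
     \<lparr>carrier = mod_hom R M N,
      monoid.mult = (\<lambda>f g. \<lambda>x\<in>carrier M. f x \<oplus>\<^bsub>N\<^esub> g x),
      one = (\<lambda>x\<in>carrier M. \<zero>\<^bsub>N\<^esub>)\<rparr>"

definition quotient_module :: "('a, 'b) ring_scheme \<Rightarrow> 'a set \<Rightarrow> ('a, 'a set) module" where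
  "quotient_module R I = ring.extend (R Quot I)
     (module.fields (\<lambda>r C. (I +>\<^bsub>R\<^esub> r) \<otimes>\<^bsub>R Quot I\<^esub> C))"


lemma module_quotient_module:
  fixes R (structure)
  assumes "cring R" "ideal I R"
  shows "module R (quotient_module R I)"
proof -
  interpret cring R by fact
  interpret ideal I R by fact
  interpret Q: cring "R Quot I" by (rule quotient_is_cring) unfold_locales
  have hom: "(+>) I \<in> ring_hom R (R Quot I)" by (rule rcos_ring_hom)
  have simps [simp]: "carrier (quotient_module R I) = carrier (R Quot I)"
    "zero (quotient_module R I) = zero (R Quot I)"
    "add (quotient_module R I) = add (R Quot I)"
    "smult (quotient_module R I) = (\<lambda>r C. (I +> r) \<otimes>\<^bsub>R Quot I\<^esub> C)"
    by (simp_all add: quotient_module_def ring.defs module.defs)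
  note [simp] = ring_hom_closed[OF hom] ring_hom_add[OF hom] ring_hom_mult[OF hom] ring_hom_one[OF hom]
  show ?thesis
  proof (rule moduleI, goal_cases)
    case 2
    show ?case
    proof (rule abelian_groupI, goal_cases)
      case (6 C)
      then show ?case by (auto intro!: bexI[of _ "\<ominus>\<^bsub>R Quot I\<^esub> C"] simp: Q.l_neg)
    qed (auto simp: Q.a_ac)
  qed (auto simp: assms Q.l_distr Q.r_distr Q.m_assoc)
qed


section \<open>Free resolutions\<close>

text \<open>\<open>\<dots> \<rightarrow> F 2 \<rightarrow> F 1 \<rightarrow> F 0 \<rightarrow> N \<rightarrow> 0\<close> with differentials \<open>d n : F (n + 1) \<rightarrow> F n\<close> and
  augmentation \<open>\<epsilon> : F 0 \<rightarrow> N\<close>.\<close>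

definition free_resolution :: "('a, 'b) ring_scheme \<Rightarrow> ('a, 'n, 'c) module_scheme \<Rightarrow>
    (nat \<Rightarrow> ('a, 'f) module) \<Rightarrow> (nat \<Rightarrow> 'f \<Rightarrow> 'f) \<Rightarrow> ('f \<Rightarrow> 'n) \<Rightarrow> bool" where
  "free_resolution R N F d \<epsilon> \<longleftrightarrow>
     (\<forall>n. free_module R (F n)) \<and>
     (\<forall>n. d n \<in> mod_hom R (F (Suc n)) (F n)) \<and>
     \<epsilon> \<in> mod_hom R (F 0) N \<and>
     \<epsilon> ` carrier (F 0) = carrier N \<and>
     d 0 ` carrier (F 1) = module_ker (F 0) N \<epsilon> \<and>
     (\<forall>n. d (Suc n) ` carrier (F (Suc (Suc n))) = module_ker (F (Suc n)) (F n) (d n))"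

text \<open>A type of basis symbols large enough to name the bases of a free resolution of any module
  with carrier type \<open>'n\<close>: \<open>Gen x\<close> for an element \<open>x\<close> of the module, and \<open>Rel [(s\<^sub>1, r\<^sub>1), \<dots>]\<close>
  for the syzygy \<open>r\<^sub>1 s\<^sub>1 + \<dots>\<close>.  The theorem \<open>free_resolution_exists\<close> below shows that every
  module has a free resolution whose terms consist of functions from symbols to the ring.\<close>

datatype ('r, 'n) symbol = Gen 'n | Rel "(('r, 'n) symbol \<times> 'r) list"

type_synonym ('r, 'n) free_elem = "('r, 'n) symbol \<Rightarrow> 'r"

definition function_module :: "('a, 'b) ring_scheme \<Rightarrow> 'i set \<Rightarrow> ('a, 'i \<Rightarrow> 'a) module" where
  "function_module R I =
     \<lparr>carrier = {f. (\<forall>i. f i \<in> carrier R) \<and> (\<forall>i. i \<notin> I \<longrightarrow> f i = \<zero>\<^bsub>R\<^esub>) \<and> finite {i. f i \<noteq> \<zero>\<^bsub>R\<^esub>}},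
      monoid.mult = (\<lambda>f g i. f i \<otimes>\<^bsub>R\<^esub> g i), one = (\<lambda>i. \<one>\<^bsub>R\<^esub>), \<comment> \<open>irrelevant for the module structure\<close>
      zero = (\<lambda>i. \<zero>\<^bsub>R\<^esub>), add = (\<lambda>f g i. f i \<oplus>\<^bsub>R\<^esub> g i),
      module.smult = (\<lambda>r f i. r \<otimes>\<^bsub>R\<^esub> f i)\<rparr>"

lemma function_module_simps [simp]:
  "\<zero>\<^bsub>function_module R I\<^esub> = (\<lambda>i. \<zero>\<^bsub>R\<^esub>)"
  "f \<oplus>\<^bsub>function_module R I\<^esub> g = (\<lambda>i. f i \<oplus>\<^bsub>R\<^esub> g i)"
  "r \<odot>\<^bsub>function_module R I\<^esub> f = (\<lambda>i. r \<otimes>\<^bsub>R\<^esub> f i)"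
  by (simp_all add: function_module_def)

lemma function_module_carrier:
  "f \<in> carrier (function_module R I) \<longleftrightarrow>
     (\<forall>i. f i \<in> carrier R) \<and> (\<forall>i. i \<notin> I \<longrightarrow> f i = \<zero>\<^bsub>R\<^esub>) \<and> finite {i. f i \<noteq> \<zero>\<^bsub>R\<^esub>}"
  by (simp add: function_module_def)

lemma module_function_module:
  fixes R (structure)
  assumes "cring R"
  shows "module R (function_module R I)"
proof -
  interpret cring R by fact
  have add: "(\<lambda>i. f i \<oplus> g i) \<in> carrier (function_module R I)"
    if "f \<in> carrier (function_module R I)" "g \<in> carrier (function_module R I)" for f g
  proof -
    have "{i. f i \<oplus> g i \<noteq> \<zero>} \<subseteq> {i. f i \<noteq> \<zero>} \<union> {i. g i \<noteq> \<zero>}" by auto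
    moreover have "finite ({i. f i \<noteq> \<zero>} \<union> {i. g i \<noteq> \<zero>})"
      using that by (simp add: function_module_carrier)
    ultimately show ?thesis using that finite_subset by (auto simp: function_module_carrier)
  qed
  have smult: "(\<lambda>i. r \<otimes> f i) \<in> carrier (function_module R I)"
    if "f \<in> carrier (function_module R I)" "r \<in> carrier R" for f r
  proof -
    have "{i. r \<otimes> f i \<noteq> \<zero>} \<subseteq> {i. f i \<noteq> \<zero>}" using that by auto
    then show ?thesis using that finite_subset by (auto simp: function_module_carrier)
  qed
  have neg: "(\<lambda>i. \<ominus> f i) \<in> carrier (function_module R I)"
    if "f \<in> carrier (function_module R I)" for f
  proof -
    have "{i. \<ominus> f i \<noteq> \<zero>} \<subseteq> {i. f i \<noteq> \<zero>}" using that by auto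
    then show ?thesis using that finite_subset by (auto simp: function_module_carrier)
  qed
  have ab: "abelian_group (function_module R I)"
  proof (rule abelian_groupI, goal_cases)
    case (6 f)
    then show ?case
      by (intro bexI[OF _ neg[OF 6]]) (auto simp: function_module_carrier l_neg)
  next
    case (1 f g)
    then show ?case using add by simp
  qed (auto simp: a_ac function_module_carrier fun_eq_iff)
  show ?thesis
  proof (rule moduleI, goal_cases)
    case (3 r f)
    then show ?case using smult by simp
  qed (auto simp: assms ab l_distr r_distr m_assoc function_module_carrier fun_eq_iff)
qed

lemma finsum_function_module:
  fixes R (structure)
  assumes "cring R" "finite A" "g \<in> A \<rightarrow> carrier (function_module R I)"
  shows "(\<Oplus>\<^bsub>function_module R I\<^esub>a\<in>A. g a) i = (\<Oplus>a\<in>A. g a i)"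
proof -
  interpret cring R by fact
  interpret M: module R "function_module R I" by (rule module_function_module) fact
  show ?thesis
    using assms(2,3)
  proof (induction A)
    case (insert a A)
    moreover have "(\<lambda>a. g a i) \<in> A \<rightarrow> carrier R" "g a i \<in> carrier R"
      using insert by (auto simp: function_module_carrier Pi_iff)
    ultimately show ?case by auto
  qed auto
qed

lemma free_module_function_module:
  fixes R (structure) and I :: "'i set"
  assumes "cring R"
  shows "free_module R (function_module R I)"
proof -
  interpret cring R by fact
  let ?F = "function_module R I"
  interpret M: module R ?F by (rule module_function_module) fact
  define e where "e = (\<lambda>j i :: 'i. if i = j then \<one> else \<zero>)"
  have e: "e j \<in> carrier ?F" if "j \<in> I" for j
    using that by (auto simp: function_module_carrier e_def)
  have span: "f \<in> H" if H: "submodule H R ?F" "e ` I \<subseteq> H" and f: "f \<in> carrier ?F" for f H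
  proof -
    interpret H: submodule H R ?F by fact
    have "f \<in> carrier ?F \<Longrightarrow> {i. f i \<noteq> \<zero>} \<subseteq> S \<Longrightarrow> f \<in> H" if "finite S" for S
      using that
    proof (induction S arbitrary: f)
      case empty
      then have "f = \<zero>\<^bsub>?F\<^esub>" by auto
      then show ?case using H.one_closed by simp
    next
      case (insert j S)
      show ?case
      proof (cases "j \<in> I")
        case False
        then have "f j = \<zero>" using insert.prems by (simp add: function_module_carrier)
        then show ?thesis using insert by blast
      next
        case True
        define g where "g = f(j := \<zero>)"
        have "{i. g i \<noteq> \<zero>} \<subseteq> {i. f i \<noteq> \<zero>}" by (auto simp: g_def)
        then have "g \<in> carrier ?F"
          using insert.prems finite_subset[of "{i. g i \<noteq> \<zero>}" "{i. f i \<noteq> \<zero>}"]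
          by (simp add: function_module_carrier) (simp add: g_def)
        moreover have "{i. g i \<noteq> \<zero>} \<subseteq> S" using insert.prems by (auto simp: g_def)
        ultimately have "g \<in> H" using insert.IH by blast
        moreover have fj: "f j \<in> carrier R" using insert.prems by (simp add: function_module_carrier)
        then have "f j \<odot>\<^bsub>?F\<^esub> e j \<in> H" using H.smult_closed True H by blast
        ultimately have "g \<oplus>\<^bsub>?F\<^esub> f j \<odot>\<^bsub>?F\<^esub> e j \<in> H" using H.m_closed by simp
        moreover have "g \<oplus>\<^bsub>?F\<^esub> f j \<odot>\<^bsub>?F\<^esub> e j = f"
          using insert.prems by (auto simp: g_def e_def function_module_carrier fun_eq_iff)
        ultimately show ?thesis by simp
      qed
    qed
    then show ?thesis using f by (auto simp: function_module_carrier)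
  qed
  have "module_span R ?F (e ` I) = carrier ?F"
    unfolding module_span_def
    using span e M.carrier_is_submodule by fast
  moreover have "linearly_independent R ?F (e ` I)"
    unfolding linearly_independent_def
  proof (intro allI impI ballI, elim conjE)
    fix A c b
    assume A: "finite A" "A \<subseteq> e ` I" and c: "c \<in> A \<rightarrow> carrier R" and b: "b \<in> A"
      and 0: "(\<Oplus>\<^bsub>?F\<^esub>b\<in>A. c b \<odot>\<^bsub>?F\<^esub> b) = \<zero>\<^bsub>?F\<^esub>"
    obtain j where j: "j \<in> I" "b = e j" using A b by auto
    have cl: "a \<in> carrier ?F" "a j \<in> carrier R" "c a \<in> carrier R" if "a \<in> A" for a
      using that A e c by (auto simp: function_module_carrier Pi_iff)
    have "\<zero> = (\<Oplus>\<^bsub>?F\<^esub>b\<in>A. c b \<odot>\<^bsub>?F\<^esub> b) j" using 0 by simp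
    also have "\<dots> = (\<Oplus>a\<in>A. (c a \<odot>\<^bsub>?F\<^esub> a) j)"
      using A cl M.smult_closed by (intro finsum_function_module assms) auto
    also have "\<dots> = (\<Oplus>a\<in>A. if b = a then c a else \<zero>)"
    proof (rule finsum_cong', simp)
      fix a assume a: "a \<in> A"
      then obtain k where k: "k \<in> I" "a = e k" using A by auto
      show "(c a \<odot>\<^bsub>?F\<^esub> a) j = (if b = a then c a else \<zero>)"
      proof (cases "k = j")
        case True
        then show ?thesis using j k cl[OF a] by (simp add: e_def)
      next
        case False
        then have "a j = \<zero>" using k by (simp add: e_def)
        moreover have "c a = \<zero>" if "b = a"
        proof -
          have "b j = \<one>" using j by (simp add: e_def)
          with that \<open>a j = \<zero>\<close> have "\<one> = \<zero>" by simp
          then show ?thesis using cl[OF a] one_zeroD by blast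
        qed
        ultimately show ?thesis using cl[OF a] by simp
      qed
    qed (use cl in auto)
    also have "\<dots> = c b"
      using A b c by (intro add.finprod_singleton) auto
    finally show "c b = \<zero>" by simp
  qed
  ultimately show ?thesis
    unfolding free_module_def using M.module_axioms e by (intro conjI exI[of _ "e ` I"]) (auto intro: module_function_module assms)
qed

lemma function_module_hom_exists:
  fixes R (structure) and N (structure)
  assumes "module R N" "\<phi> \<in> I \<rightarrow> carrier N"
  shows "\<exists>h \<in> mod_hom R (function_module R I) N. \<phi> ` I \<subseteq> h ` carrier (function_module R I) \<and>
           (\<forall>H. submodule H R N \<and> \<phi> ` I \<subseteq> H \<longrightarrow> h ` carrier (function_module R I) \<subseteq> H)"
proof -
  interpret N: module R N by fact
  let ?F = "function_module R I"
  interpret M: module R ?F by (rule module_function_module) unfold_locales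
  define h where "h = (\<lambda>f\<in>carrier ?F. \<Oplus>\<^bsub>N\<^esub>i\<in>{i. f i \<noteq> \<zero>\<^bsub>R\<^esub>}. f i \<odot>\<^bsub>N\<^esub> \<phi> i)"
  have fI: "{i. f i \<noteq> \<zero>\<^bsub>R\<^esub>} \<subseteq> I" "finite {i. f i \<noteq> \<zero>\<^bsub>R\<^esub>}" "f i \<in> carrier R"
    if "f \<in> carrier ?F" for f i
    using that by (auto simp: function_module_carrier)
  have cl: "f i \<odot>\<^bsub>N\<^esub> \<phi> i \<in> carrier N" if "f \<in> carrier ?F" "i \<in> I" for f i
    using that assms fI by (auto simp: Pi_iff)
  have h: "h f = (\<Oplus>\<^bsub>N\<^esub>i\<in>S. f i \<odot>\<^bsub>N\<^esub> \<phi> i)"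
    if "f \<in> carrier ?F" "finite S" "S \<subseteq> I" "{i. f i \<noteq> \<zero>\<^bsub>R\<^esub>} \<subseteq> S" for f S
  proof -
    have "(\<Oplus>\<^bsub>N\<^esub>i\<in>{i. f i \<noteq> \<zero>\<^bsub>R\<^esub>}. f i \<odot>\<^bsub>N\<^esub> \<phi> i) = (\<Oplus>\<^bsub>N\<^esub>i\<in>S. f i \<odot>\<^bsub>N\<^esub> \<phi> i)"
    proof (rule N.add.finprod_mono_neutral_cong_left)
      show "f i \<odot>\<^bsub>N\<^esub> \<phi> i = \<zero>\<^bsub>N\<^esub>" if "i \<in> S - {i. f i \<noteq> \<zero>\<^bsub>R\<^esub>}" for i
        using that \<open>S \<subseteq> I\<close> assms(2) by (auto simp: Pi_iff subset_iff)
    qed (use that cl in auto)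
    then show ?thesis using that by (simp add: h_def)
  qed
  have carr: "h f \<in> carrier N" if "f \<in> carrier ?F" for f
    using that cl fI(1)[OF that] by (auto simp: h_def intro!: N.M.finsum_closed)
  have hom: "h \<in> mod_hom R ?F N"
  proof -
    have "h (f \<oplus>\<^bsub>?F\<^esub> g) = h f \<oplus>\<^bsub>N\<^esub> h g" if f: "f \<in> carrier ?F" and g: "g \<in> carrier ?F" for f g
    proof -
      define S where "S = {i. f i \<noteq> \<zero>\<^bsub>R\<^esub>} \<union> {i. g i \<noteq> \<zero>\<^bsub>R\<^esub>}"
      have S: "finite S" "S \<subseteq> I" using fI f g by (auto simp: S_def)
      have fg: "f \<oplus>\<^bsub>?F\<^esub> g \<in> carrier ?F" using f g by (rule M.a_closed)
      have "h (f \<oplus>\<^bsub>?F\<^esub> g) = (\<Oplus>\<^bsub>N\<^esub>i\<in>S. (f \<oplus>\<^bsub>?F\<^esub> g) i \<odot>\<^bsub>N\<^esub> \<phi> i)"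
        by (rule h[OF fg S]) (auto simp: S_def)
      also have "\<dots> = (\<Oplus>\<^bsub>N\<^esub>i\<in>S. f i \<odot>\<^bsub>N\<^esub> \<phi> i \<oplus>\<^bsub>N\<^esub> g i \<odot>\<^bsub>N\<^esub> \<phi> i)"
        using S f g fI assms(2) cl
        by (intro N.M.finsum_cong') (auto intro!: N.smult_l_distr simp: Pi_iff subset_iff)
      also have "\<dots> = (\<Oplus>\<^bsub>N\<^esub>i\<in>S. f i \<odot>\<^bsub>N\<^esub> \<phi> i) \<oplus>\<^bsub>N\<^esub> (\<Oplus>\<^bsub>N\<^esub>i\<in>S. g i \<odot>\<^bsub>N\<^esub> \<phi> i)"
        using S f g cl by (intro N.M.finsum_addf) auto
      also have "\<dots> = h f \<oplus>\<^bsub>N\<^esub> h g"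
        using h[OF f S] h[OF g S] by (simp add: S_def)
      finally show ?thesis .
    qed
    moreover have "h (r \<odot>\<^bsub>?F\<^esub> f) = r \<odot>\<^bsub>N\<^esub> h f" if r: "r \<in> carrier R" and f: "f \<in> carrier ?F" for f r
    proof -
      let ?S = "{i. f i \<noteq> \<zero>\<^bsub>R\<^esub>}"
      have rf: "r \<odot>\<^bsub>?F\<^esub> f \<in> carrier ?F" using r f by (rule M.smult_closed)
      have "h (r \<odot>\<^bsub>?F\<^esub> f) = (\<Oplus>\<^bsub>N\<^esub>i\<in>?S. (r \<odot>\<^bsub>?F\<^esub> f) i \<odot>\<^bsub>N\<^esub> \<phi> i)"
        by (rule h[OF rf fI(2)[OF f] fI(1)[OF f]]) (use r f in auto)
      also have "\<dots> = (\<Oplus>\<^bsub>N\<^esub>i\<in>?S. r \<odot>\<^bsub>N\<^esub> (f i \<odot>\<^bsub>N\<^esub> \<phi> i))"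
        using r f fI cl assms(2)
        by (intro N.M.finsum_cong') (auto intro!: N.smult_assoc1 N.smult_closed simp: Pi_iff subset_iff)
      also have "\<dots> = r \<odot>\<^bsub>N\<^esub> (\<Oplus>\<^bsub>N\<^esub>i\<in>?S. f i \<odot>\<^bsub>N\<^esub> \<phi> i)"
        using fI(1)[OF f] cl f r by (intro N.finsum_smult_ldistr[symmetric] fI(2)[OF f]) auto
      finally show ?thesis using f by (simp add: h_def)
    qed
    ultimately show ?thesis
      using carr by (auto simp: mod_hom_def h_def PiE_iff extensional_def)
  qed
  moreover have "\<phi> ` I \<subseteq> h ` carrier ?F"
  proof
    fix y assume "y \<in> \<phi> ` I"
    then obtain j where j: "j \<in> I" "y = \<phi> j" by auto
    define e where "e = (\<lambda>i. if i = j then \<one>\<^bsub>R\<^esub> else \<zero>\<^bsub>R\<^esub>)"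
    have e: "e \<in> carrier ?F" using j by (auto simp: function_module_carrier e_def)
    have "h e = (\<Oplus>\<^bsub>N\<^esub>i\<in>{j}. e i \<odot>\<^bsub>N\<^esub> \<phi> i)"
      by (rule h[OF e]) (use j in \<open>auto simp: e_def\<close>)
    also have "\<dots> = y" using j assms(2) by (auto simp: e_def Pi_iff)
    finally show "y \<in> h ` carrier ?F" using e by blast
  qed
  moreover have "h ` carrier ?F \<subseteq> H" if H: "submodule H R N" "\<phi> ` I \<subseteq> H" for H
  proof -
    interpret H: submodule H R N by fact
    have "(\<Oplus>\<^bsub>N\<^esub>i\<in>S. f i \<odot>\<^bsub>N\<^esub> \<phi> i) \<in> H" if "finite S" "S \<subseteq> I" "f \<in> carrier ?F" for S f
      using that
    proof (induction S)
      case empty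
      then show ?case using H.one_closed by simp
    next
      case (insert i S)
      have "f i \<odot>\<^bsub>N\<^esub> \<phi> i \<in> H"
        using insert.prems H fI by (intro H.smult_closed) auto
      then have "f i \<odot>\<^bsub>N\<^esub> \<phi> i \<oplus>\<^bsub>N\<^esub> (\<Oplus>\<^bsub>N\<^esub>i\<in>S. f i \<odot>\<^bsub>N\<^esub> \<phi> i) \<in> H"
        using insert H.m_closed by simp
      moreover have "(\<lambda>i. f i \<odot>\<^bsub>N\<^esub> \<phi> i) \<in> S \<rightarrow> carrier N" "f i \<odot>\<^bsub>N\<^esub> \<phi> i \<in> carrier N"
        using insert.prems cl by auto
      ultimately show ?case using insert.hyps by (simp add: N.M.finsum_insert)
    qed
    then show ?thesis using fI by (auto simp: h_def)
  qed
  ultimately show ?thesis by blast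
qed

lemma submodule_module_ker:
  assumes "module R M" "module R N" "h \<in> mod_hom R M N"
  shows "submodule (module_ker M N h) R M"
proof -
  interpret M: module R M by fact
  interpret N: module R N by fact
  have cl: "h x \<in> carrier N" if "x \<in> carrier M" for x
    using assms(3) that by (auto simp: mod_hom_def)
  have add: "h (x \<oplus>\<^bsub>M\<^esub> y) = h x \<oplus>\<^bsub>N\<^esub> h y" if "x \<in> carrier M" "y \<in> carrier M" for x y
    using assms(3) that by (auto simp: mod_hom_def)
  have smult: "h (r \<odot>\<^bsub>M\<^esub> x) = r \<odot>\<^bsub>N\<^esub> h x" if "x \<in> carrier M" "r \<in> carrier R" for x r
    using assms(3) that by (auto simp: mod_hom_def)
  have zero: "h \<zero>\<^bsub>M\<^esub> = \<zero>\<^bsub>N\<^esub>"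
    using smult[of "\<zero>\<^bsub>M\<^esub>" "\<zero>\<^bsub>R\<^esub>"] cl[of "\<zero>\<^bsub>M\<^esub>"] by simp
  have neg: "h (\<ominus>\<^bsub>M\<^esub> x) = \<zero>\<^bsub>N\<^esub>" if "x \<in> carrier M" "h x = \<zero>\<^bsub>N\<^esub>" for x
    using add[of x "\<ominus>\<^bsub>M\<^esub> x"] cl[of "\<ominus>\<^bsub>M\<^esub> x"] that zero by (simp add: M.r_neg)
  show ?thesis
    by (rule M.submoduleI) (auto simp: module_ker_def zero neg add smult)
qed

theorem free_resolution_exists:
  fixes R :: "('a, 'b) ring_scheme" and N :: "('a, 'n, 'c) module_scheme"
  assumes "module R N"
  shows "\<exists>(F :: nat \<Rightarrow> ('a, ('a, 'n) free_elem) module) d \<epsilon>. free_resolution R N F d \<epsilon>"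
proof -
  interpret N: module R N by fact
  have R: "cring R" by unfold_locales
  let ?\<F> = "\<lambda>I :: ('a, 'n) symbol set. function_module R I"
  have F: "module R (?\<F> I)" for I by (rule module_function_module) fact
  define graph :: "('a, 'n) free_elem \<Rightarrow> (('a, 'n) symbol \<times> 'a) set" where
    "graph f = (\<lambda>i. (i, f i)) ` {i. f i \<noteq> \<zero>\<^bsub>R\<^esub>}" for f
  define code :: "('a, 'n) free_elem \<Rightarrow> ('a, 'n) symbol" where
    "code f = Rel (SOME l. set l = graph f)" for f
  have code: "f = g"
    if fg: "finite {i. f i \<noteq> \<zero>\<^bsub>R\<^esub>}" "finite {i. g i \<noteq> \<zero>\<^bsub>R\<^esub>}" "code f = code g" for f g
  proof -
    have ex: "set (SOME l. set l = graph f) = graph f"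
      if "finite {i. f i \<noteq> \<zero>\<^bsub>R\<^esub>}" for f :: "('a, 'n) free_elem"
    proof (rule someI_ex)
      have "finite (graph f)" unfolding graph_def using that by (rule finite_imageI)
      then show "\<exists>l. set l = graph f" by (rule finite_list)
    qed
    have "(SOME l. set l = graph f) = (SOME l. set l = graph g)"
      using fg(3) unfolding code_def by (rule symbol.inject(2)[THEN iffD1])
    then have eq: "graph f = graph g" using ex[OF fg(1)] ex[OF fg(2)] by metis
    have mem: "(i, x) \<in> graph f \<longleftrightarrow> f i = x \<and> x \<noteq> \<zero>\<^bsub>R\<^esub>" for i x and f :: "('a, 'n) free_elem"
      unfolding graph_def by (auto simp: image_iff)
    have "f i = g i" for i using mem[of i _ f] mem[of i _ g] unfolding eq by metis
    then show "f = g" by (rule ext)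
  qed
  have cover: "\<exists>J h. h \<in> mod_hom R (?\<F> J) (?\<F> I) \<and> h ` carrier (?\<F> J) = K"
    if K: "submodule K R (?\<F> I)" for I K
  proof -
    have sub: "K \<subseteq> carrier (?\<F> I)" using module.submoduleE(1)[OF F K] .
    have inj: "inj_on code K"
      by (rule inj_onI, rule code) (use sub in \<open>auto simp: function_module_carrier\<close>)
    have im: "inv_into K code ` (code ` K) = K" using inj by force
    have "inv_into K code \<in> code ` K \<rightarrow> carrier (?\<F> I)"
      using im sub by (simp add: Pi_iff image_subset_iff[symmetric] del: inv_into_image_cancel)
    from function_module_hom_exists[OF F this, unfolded im] obtain h
      where h: "h \<in> mod_hom R (?\<F> (code ` K)) (?\<F> I)"
        and K1: "K \<subseteq> h ` carrier (?\<F> (code ` K)) \<and>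
          (\<forall>H. submodule H R (?\<F> I) \<and> K \<subseteq> H \<longrightarrow> h ` carrier (?\<F> (code ` K)) \<subseteq> H)"
      by (rule bexE)
    have "h ` carrier (?\<F> (code ` K)) \<subseteq> K"
      by (rule K1[THEN conjunct2, rule_format, OF conjI, OF K subset_refl])
    then have "h ` carrier (?\<F> (code ` K)) = K" by (rule equalityI[OF _ K1[THEN conjunct1]])
    with h show ?thesis by (intro exI conjI)
  qed
  have cover0: "\<exists>\<epsilon>. \<epsilon> \<in> mod_hom R (?\<F> (Gen ` carrier N)) N \<and>
      \<epsilon> ` carrier (?\<F> (Gen ` carrier N)) = carrier N"
  proof -
    define \<phi> :: "('a, 'n) symbol \<Rightarrow> 'n" where "\<phi> s = (case s of Gen x \<Rightarrow> x)" for s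
    have im: "\<phi> ` (Gen ` carrier N) = carrier N" by (force simp: \<phi>_def)
    then have "\<phi> \<in> Gen ` carrier N \<rightarrow> carrier N" by blast
    from function_module_hom_exists[OF assms this] obtain h
      where h: "h \<in> mod_hom R (?\<F> (Gen ` carrier N)) N"
        and h': "\<phi> ` (Gen ` carrier N) \<subseteq> h ` carrier (?\<F> (Gen ` carrier N)) \<and>
          (\<forall>H. submodule H R N \<and> \<phi> ` (Gen ` carrier N) \<subseteq> H \<longrightarrow>
             h ` carrier (?\<F> (Gen ` carrier N)) \<subseteq> H)"
      by (rule bexE)
    from h'[unfolded im] have "carrier N \<subseteq> h ` carrier (?\<F> (Gen ` carrier N))"
      by (rule conjunct1)
    moreover have "h ` carrier (?\<F> (Gen ` carrier N)) \<subseteq> carrier N"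
      using h by (auto simp: mod_hom_def)
    ultimately show ?thesis using h by (intro exI conjI equalityI)
  qed
  then obtain \<epsilon> where \<epsilon>: "\<epsilon> \<in> mod_hom R (?\<F> (Gen ` carrier N)) N"
      "\<epsilon> ` carrier (?\<F> (Gen ` carrier N)) = carrier N" by blast
  let ?P = "\<lambda>n (I, J, h). h \<in> mod_hom R (?\<F> J) (?\<F> I) \<and>
     (n = 0 \<longrightarrow> I = Gen ` carrier N \<and> h ` carrier (?\<F> J) = module_ker (?\<F> I) N \<epsilon>)"
  let ?Q = "\<lambda>(I, J, h) (J', K, h'). J' = J \<and> h' ` carrier (?\<F> K) = module_ker (?\<F> J) (?\<F> I) h"
  have "\<exists>s. ?P 0 s"
    using cover[OF submodule_module_ker[OF F assms \<epsilon>(1)]] by auto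
  moreover have "\<exists>s'. ?P (Suc n) s' \<and> ?Q s s'" if "?P n s" for s n
  proof -
    obtain I J h where s: "s = (I, J, h)" by (cases s)
    have "h \<in> mod_hom R (?\<F> J) (?\<F> I)" using that s by simp
    from cover[OF submodule_module_ker[OF F F this]] show ?thesis using s by auto
  qed
  ultimately have "\<exists>s. \<forall>n. ?P n (s n) \<and> ?Q (s n) (s (Suc n))"
    by (rule dependent_nat_choice[of ?P "\<lambda>_. ?Q"])
  then obtain s where PQ: "\<forall>n. ?P n (s n) \<and> ?Q (s n) (s (Suc n))" by (rule exE)
  have P: "?P n (s n)" for n by (rule PQ[THEN spec, THEN conjunct1])
  have Q: "?Q (s n) (s (Suc n))" for n by (rule PQ[THEN spec, THEN conjunct2])
  define I where "I n = fst (s n)" for n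
  define d where "d n = snd (snd (s n))" for n
  have s: "s n = (I n, I (Suc n), d n)" for n
    using Q[of n] unfolding I_def d_def
    by (cases "s n"; cases "s (Suc n)") (simp only: prod.case fst_conv snd_conv)
  have dn: "d n \<in> mod_hom R (?\<F> (I (Suc n))) (?\<F> (I n))" for n
    using P[of n] unfolding s prod.case by (rule conjunct1)
  have I0: "I 0 = Gen ` carrier N" "d 0 ` carrier (?\<F> (I 1)) = module_ker (?\<F> (I 0)) N \<epsilon>"
    using P[of 0] unfolding s prod.case One_nat_def by blast+
  have ker: "d (Suc n) ` carrier (?\<F> (I (Suc (Suc n)))) = module_ker (?\<F> (I (Suc n))) (?\<F> (I n)) (d n)" for n
    using Q[of n] unfolding s prod.case by (rule conjunct2)
  have "free_resolution R N (\<lambda>n. ?\<F> (I n)) d \<epsilon>"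
    unfolding free_resolution_def
    using dn I0(2) ker \<epsilon>[folded I0(1)] free_module_function_module[OF R]
    by (intro conjI allI)
  then show ?thesis by blast
qed


section \<open>Ext and depth\<close>

text \<open>\<open>Ext_group R N M i\<close> is the \<open>i\<close>-th cohomology group of the complex
  \<open>0 \<rightarrow> Hom(F 0, M) \<rightarrow> Hom(F 1, M) \<rightarrow> \<dots>\<close> for a chosen free resolution \<open>F\<close> of \<open>N\<close>;
  as usual, another choice gives an isomorphic group.\<close>

definition chosen_resolution :: "('a, 'b) ring_scheme \<Rightarrow> ('a, 'n, 'c) module_scheme \<Rightarrow>
    (nat \<Rightarrow> ('a, ('a, 'n) free_elem) module) \<times>
    (nat \<Rightarrow> ('a, 'n) free_elem \<Rightarrow> ('a, 'n) free_elem)" where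
  "chosen_resolution R N = (SOME (F, d). \<exists>\<epsilon>. free_resolution R N F d \<epsilon>)"

lemma chosen_resolution:
  fixes R :: "('a, 'b) ring_scheme" and N :: "('a, 'n, 'c) module_scheme"
  assumes "module R N" "chosen_resolution R N = (F, d)"
  shows "\<exists>\<epsilon>. free_resolution R N F d \<epsilon>"
proof -
  have "\<exists>p. case p of (F, d) \<Rightarrow> \<exists>\<epsilon>. free_resolution R N F
      (d :: nat \<Rightarrow> ('a, 'n) free_elem \<Rightarrow> ('a, 'n) free_elem) \<epsilon>"
    using free_resolution_exists[OF assms(1)] by auto
  from someI_ex[OF this] show ?thesis
    using assms(2) unfolding chosen_resolution_def by (auto split: prod.splits)
qed

definition cocycles :: "('a, 'b) ring_scheme \<Rightarrow> (nat \<Rightarrow> ('a, 'f) module) \<Rightarrow> (nat \<Rightarrow> 'f \<Rightarrow> 'f) \<Rightarrow>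
    ('a, 'm, 'c) module_scheme \<Rightarrow> nat \<Rightarrow> ('f \<Rightarrow> 'm) set" where
  "cocycles R F d M i = {f \<in> mod_hom R (F i) M.
     compose (carrier (F (Suc i))) f (d i) = \<one>\<^bsub>Hom_group R (F (Suc i)) M\<^esub>}"

fun coboundaries :: "('a, 'b) ring_scheme \<Rightarrow> (nat \<Rightarrow> ('a, 'f) module) \<Rightarrow> (nat \<Rightarrow> 'f \<Rightarrow> 'f) \<Rightarrow>
    ('a, 'm, 'c) module_scheme \<Rightarrow> nat \<Rightarrow> ('f \<Rightarrow> 'm) set" where
  "coboundaries R F d M 0 = {\<one>\<^bsub>Hom_group R (F 0) M\<^esub>}"
| "coboundaries R F d M (Suc i) =
     (\<lambda>f. compose (carrier (F (Suc i))) f (d i)) ` mod_hom R (F i) M"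

definition cohomology_group :: "('a, 'b) ring_scheme \<Rightarrow> (nat \<Rightarrow> ('a, 'f) module) \<Rightarrow>
    (nat \<Rightarrow> 'f \<Rightarrow> 'f) \<Rightarrow> ('a, 'm, 'c) module_scheme \<Rightarrow> nat \<Rightarrow> ('f \<Rightarrow> 'm) set monoid" where
  "cohomology_group R F d M i =
     (Hom_group R (F i) M)\<lparr>carrier := cocycles R F d M i\<rparr> Mod coboundaries R F d M i"

definition Ext_group :: "('a, 'b) ring_scheme \<Rightarrow> ('a, 'n, 'c) module_scheme \<Rightarrow>
    ('a, 'm, 'd) module_scheme \<Rightarrow> nat \<Rightarrow> (('a, 'n) free_elem \<Rightarrow> 'm) set monoid" where
  "Ext_group R N M i = (case chosen_resolution R N of (F, d) \<Rightarrow> cohomology_group R F d M i)"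

text \<open>The infimum of the empty set in \<^typ>\<open>enat\<close> is \<open>\<infinity>\<close>.\<close>

definition depth :: "('a, 'b) ring_scheme \<Rightarrow> ('a, 'm, 'c) module_scheme \<Rightarrow> enat" where
  "depth R M = Inf {enat i | i.
     carrier (Ext_group R (quotient_module R (the_maximal_ideal R)) M i) \<noteq>
       {\<one>\<^bsub>Ext_group R (quotient_module R (the_maximal_ideal R)) M i\<^esub>}}"

definition maximal_Cohen_Macaulay ::
    "('a, 'b) ring_scheme \<Rightarrow> ('a, 'm, 'c) module_scheme \<Rightarrow> bool" where
  "maximal_Cohen_Macaulay R M \<longleftrightarrow> module R M \<and> depth R M = krull_dim R"

end

theory Submission
  imports Defs
begin

text \<open>If the maximal ideal \<open>\<mm>\<close> is generated by \<open>n\<close> elements and \<open>Ext\<^sup>i(R/\<mm>, M) = 0\<close> for all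
  \<open>i < n\<close>, then prime avoidance in cosets \<open>x + J\<close> turns the generators one by one into an
  \<open>M\<close>-regular sequence \<open>y\<^sub>1, \<dots>, y\<^sub>n\<close> that still generates \<open>\<mm>\<close>. Fix a minimal generating set of \<open>M\<close>.
  Any relation modulo \<open>\<mm>M\<close> has its coefficients in \<open>\<mm>\<close>. If all relations modulo
  \<open>(y\<^sub>1, \<dots>, y\<^sub>k)M\<close> have their coefficients in \<open>(y\<^sub>1, \<dots>, y\<^sub>k)\<close>, then regularity of \<open>y\<^sub>k\<close> and
  Nakayama's lemma give the same for \<open>k - 1\<close>; for \<open>k = 0\<close> this is linear independence.
  The Krull dimension enters only as the number \<open>n\<close> of generators.\<close>

section \<open>Noetherian local rings\<close>

text \<open>The descent has to start at \<mm> itself, where minimality of the generators of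
  \<open>M\<close> applies, so the regular elements must generate all of \<mm>. Arbitrary regular
  elements of \<mm> would not do so, but \<open>x + j\<close> with \<open>j\<close> in the ideal
  \<open>J\<close> of the remaining generators can be exchanged for \<open>x\<close>. Since \<mm> is
  generated by \<open>I\<close>, \<open>x\<close> and \<open>J\<close>, such an element can be made
  regular on \<open>M / I M\<close> once no nonzero class there is killed by \<mm>; this is
  vanishing in degree 0. Passing to the quotient by a regular element costs one degree of vanishing,
  so \<open>n\<close> degrees pay for \<open>n\<close> elements. Ext is computed from one chosen
  resolution of \<open>R / \<mm>\<close>. To keep it and \<open>M\<close> fixed, the quotients
  \<open>M / I M\<close> are never formed: classes are represented by elements of \<open>M\<close>,
  and equations become congruences modulo a submodule. In the descent, a relation modulo
  \<open>I M\<close> with coefficients \<open>i + t y\<close> yields the relation with coefficients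
  \<open>t\<close>, so modulo \<open>I\<close> the coefficients of relations form a set contained in
  \<open>y\<close> times itself.\<close>

lemma (in ring) idealI':
  assumes "I \<subseteq> carrier R" "\<zero> \<in> I"
    and "\<And>a b. a \<in> I \<Longrightarrow> b \<in> I \<Longrightarrow> a \<oplus> b \<in> I"
    and "\<And>a x. a \<in> I \<Longrightarrow> x \<in> carrier R \<Longrightarrow> x \<otimes> a \<in> I"
    and "\<And>a x. a \<in> I \<Longrightarrow> x \<in> carrier R \<Longrightarrow> a \<otimes> x \<in> I"
  shows "ideal I R"
proof (rule idealI[OF ring_axioms])
  show "subgroup I (add_monoid R)"
  proof (rule subgroup.intro)
    fix a assume a: "a \<in> I"
    then have "\<ominus> a = (\<ominus> \<one>) \<otimes> a" using assms(1) l_minus[of \<one> a] by auto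
    then show "inv\<^bsub>add_monoid R\<^esub> a \<in> I"
      using assms(4)[OF a, of "\<ominus> \<one>"] by (simp add: a_inv_def)
  qed (use assms in auto)
qed (use assms in auto)

lemma (in cring) cidealI:
  assumes "I \<subseteq> carrier R" "\<zero> \<in> I"
    and "\<And>a b. a \<in> I \<Longrightarrow> b \<in> I \<Longrightarrow> a \<oplus> b \<in> I"
    and "\<And>a x. a \<in> I \<Longrightarrow> x \<in> carrier R \<Longrightarrow> x \<otimes> a \<in> I"
  shows "ideal I R"
  using assms by (intro idealI') (auto simp: m_comm subset_iff)

text \<open>A nonempty chain of ideals in a Noetherian ring contains its own union, so Zorn's lemma
  applies to any family \<open>C\<close>. Starting above a prescribed \<open>I0\<close> puts a given
  proper ideal or annihilator below a maximal one.\<close>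

lemma (in noetherian_ring) maximal_member:
  assumes "\<And>I. I \<in> C \<Longrightarrow> ideal I R" "I0 \<in> C"
  shows "\<exists>I\<in>C. I0 \<subseteq> I \<and> (\<forall>J\<in>C. I \<subseteq> J \<longrightarrow> J = I)"
proof -
  let ?D = "{I \<in> C. I0 \<subseteq> I}"
  have "\<exists>U\<in>?D. \<forall>X\<in>c. X \<subseteq> U" if c: "subset.chain ?D c" for c
  proof (cases "c = {}")
    case False
    have "subset.chain {I. ideal I R} c" using c assms(1) by (auto simp: subset.chain_def)
    from ideal_chain_is_trivial[OF False this] have "\<Union>c \<in> c" .
    then show ?thesis using c by (auto simp: subset.chain_def)
  qed (use assms in auto)
  from subset_Zorn[of ?D, OF this] obtain I
    where "I \<in> ?D" and I: "\<forall>X\<in>?D. I \<subseteq> X \<longrightarrow> X = I" by blast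
  then show ?thesis by (intro bexI[of _ I]) auto
qed

section \<open>Ideals \<open>I + (y)\<close>, Nakayama's lemma and prime avoidance\<close>

lemma (in cring) mem_add_cgenideal:
  "c \<in> I <+>\<^bsub>R\<^esub> PIdl y \<longleftrightarrow> (\<exists>i\<in>I. \<exists>t\<in>carrier R. c = i \<oplus> t \<otimes> y)"
  by (auto simp: set_add_def' cgenideal_def)

lemma (in cring) ideal_add_cgenideal:
  assumes "ideal I R" "y \<in> carrier R"
  shows "ideal (I <+>\<^bsub>R\<^esub> PIdl y) R" "I \<subseteq> I <+>\<^bsub>R\<^esub> PIdl y" "y \<in> I <+>\<^bsub>R\<^esub> PIdl y"
proof -
  interpret I: ideal I R by fact
  show "ideal (I <+>\<^bsub>R\<^esub> PIdl y) R" by (intro add_ideals cgenideal_ideal assms)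
  show "I \<subseteq> I <+>\<^bsub>R\<^esub> PIdl y"
  proof
    fix i assume i: "i \<in> I"
    then have "i = i \<oplus> \<zero> \<otimes> y" using I.Icarr assms(2) by auto
    with i show "i \<in> I <+>\<^bsub>R\<^esub> PIdl y" unfolding mem_add_cgenideal by blast
  qed
  have "y = \<zero> \<oplus> \<one> \<otimes> y" using assms(2) by auto
  then show "y \<in> I <+>\<^bsub>R\<^esub> PIdl y"
    unfolding mem_add_cgenideal using I.zero_closed by blast
qed

text \<open>A nonunit generates a proper ideal; a maximal proper ideal above it must be \<mm> by
  uniqueness.\<close>

lemma (in cring) Units_avoid_maximal:
  assumes "noetherian_ring R" "\<exists>!\<mm>. maximalideal \<mm> R" "maximalideal \<mm> R" "a \<in> carrier R" "a \<notin> \<mm>"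
  shows "a \<in> Units R"
proof (rule ccontr)
  interpret noetherian_ring R by fact
  assume "a \<notin> Units R"
  then have "PIdl a \<in> {I. ideal I R \<and> I \<noteq> carrier R}"
    using assms(4) ideal_eq_carrier_iff[of a] cgenideal_ideal[of a] by auto
  from maximal_member[OF _ this] obtain I where I: "ideal I R" "I \<noteq> carrier R" "PIdl a \<subseteq> I"
    and max: "\<And>J. ideal J R \<Longrightarrow> J \<noteq> carrier R \<Longrightarrow> I \<subseteq> J \<Longrightarrow> J = I"
    by auto
  have "maximalideal I R" using I max by (intro maximalidealI) auto
  then have "I = \<mm>" using assms(2,3) by blast
  then show False using I(3) cgenideal_self[OF assms(4)] assms(5) by auto
qed

text \<open>For \<open>t \<in> J\<close> with \<open>I + (t)\<close> maximal, \<open>t = i + s y\<close> gives \<open>I + (t) \<subseteq> I + (s)\<close>, hence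
  \<open>s \<in> I + (t)\<close> and \<open>(1 - r y) s \<in> I\<close> for some \<open>r\<close>.\<close>

lemma (in cring) nakayama:
  assumes noeth: "noetherian_ring R" and unit: "\<And>r. r \<in> carrier R \<Longrightarrow> \<one> \<ominus> r \<otimes> y \<in> Units R"
    and I: "ideal I R" and J: "J \<subseteq> carrier R" and y: "y \<in> carrier R"
    and dec: "\<And>c. c \<in> J \<Longrightarrow> \<exists>i\<in>I. \<exists>t\<in>J. c = i \<oplus> t \<otimes> y"
  shows "J \<subseteq> I"
proof
  fix c assume c: "c \<in> J"
  interpret noetherian_ring R by fact
  interpret I: ideal I R by fact
  \<comment> \<open>\<open>J\<close> is a bare set, so the Noetherian condition is applied to the
    ideals \<open>I + (t)\<close> with \<open>t\<close> in \<open>J\<close>.\<close>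
  let ?C = "(\<lambda>t. I <+>\<^bsub>R\<^esub> PIdl t) ` J"
  have id: "ideal L R" if "L \<in> ?C" for L using that J ideal_add_cgenideal(1)[OF I] by blast
  have "I <+>\<^bsub>R\<^esub> PIdl c \<in> ?C" using c by blast
  from maximal_member[OF id this] obtain t where t: "t \<in> J" "I <+>\<^bsub>R\<^esub> PIdl c \<subseteq> I <+>\<^bsub>R\<^esub> PIdl t"
    and max: "\<And>s. s \<in> J \<Longrightarrow> I <+>\<^bsub>R\<^esub> PIdl t \<subseteq> I <+>\<^bsub>R\<^esub> PIdl s \<Longrightarrow> I <+>\<^bsub>R\<^esub> PIdl s = I <+>\<^bsub>R\<^esub> PIdl t"
    by auto
  obtain i s where s: "i \<in> I" "s \<in> J" "t = i \<oplus> s \<otimes> y" using dec[OF t(1)] by blast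
  note S = ideal_add_cgenideal[OF I, of s]
  have carr: "i \<in> carrier R" "s \<in> carrier R" "t \<in> carrier R" using s t J I.Icarr by auto
  interpret S: ideal "I <+>\<^bsub>R\<^esub> PIdl s" R by (rule S) fact
  have "t \<in> I <+>\<^bsub>R\<^esub> PIdl s"
    unfolding mem_add_cgenideal using s y carr by (intro bexI[of _ i] bexI[of _ y]) (auto simp: m_comm)
  then have "I <+>\<^bsub>R\<^esub> PIdl t \<subseteq> I <+>\<^bsub>R\<^esub> PIdl s"
    using S carr S.I_l_closed S.a_closed by (fastforce simp: mem_add_cgenideal[of _ _ t])
  from max[OF s(2) this] have "s \<in> I <+>\<^bsub>R\<^esub> PIdl t" using S carr by auto
  then obtain k r where k: "k \<in> I" "r \<in> carrier R" "s = k \<oplus> r \<otimes> t" by (auto simp: mem_add_cgenideal)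
  have kc: "k \<in> carrier R" using k I.Icarr by auto
  have "(\<one> \<ominus> r \<otimes> y) \<otimes> s = s \<ominus> r \<otimes> (s \<otimes> y)" using k(2) y carr by algebra
  also have "\<dots> = (k \<oplus> r \<otimes> t) \<ominus> r \<otimes> (s \<otimes> y)" using k by simp
  also have "\<dots> = k \<oplus> r \<otimes> i" unfolding s(3) using k(2) kc y carr by algebra
  finally have us: "(\<one> \<ominus> r \<otimes> y) \<otimes> s \<in> I" using k(1,2) s(1) I.I_l_closed by auto
  have u: "\<one> \<ominus> r \<otimes> y \<in> Units R" using unit k(2) by auto
  have "s = inv (\<one> \<ominus> r \<otimes> y) \<otimes> ((\<one> \<ominus> r \<otimes> y) \<otimes> s)"
    using carr Units_l_inv[OF u] Units_closed[OF u] Units_inv_closed[OF u]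
    by (simp del: Units_l_inv add: m_assoc[symmetric])
  then have sI: "s \<in> I" using I.I_l_closed[OF us, of "inv (\<one> \<ominus> r \<otimes> y)"] u by simp
  then have "t \<in> I" using s(1,3) I.I_r_closed[OF sI y] by auto
  moreover have "c \<in> I <+>\<^bsub>R\<^esub> PIdl t" using t(2) ideal_add_cgenideal(3)[OF I, of c] c J by auto
  ultimately show "c \<in> I" using I.I_l_closed by (auto simp: mem_add_cgenideal)
qed

text \<open>Multiply one element from each \<open>K\<close> outside the prime: primality keeps the
  product outside, and it lies in every \<open>K\<close>. Both prime avoidance and the finiteness of
  the maximal annihilators rest on this.\<close>

lemma (in primeideal) finite_ideals_not_subset:
  assumes "finite Q" "\<And>K. K \<in> Q \<Longrightarrow> ideal K R" "\<And>K. K \<in> Q \<Longrightarrow> \<not> K \<subseteq> I"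
  shows "\<exists>b\<in>carrier R. b \<notin> I \<and> (\<forall>K\<in>Q. b \<in> K)"
  using assms
proof (induction Q)
  case empty
  have "\<one> \<notin> I" using one_imp_carrier I_notcarr by auto
  then show ?case by auto
next
  case (insert K Q)
  then obtain b where b: "b \<in> carrier R" "b \<notin> I" "\<forall>K\<in>Q. b \<in> K" by auto
  obtain a where a: "a \<in> K" "a \<notin> I" using insert.prems by blast
  have K: "ideal K R" using insert.prems by auto
  then have ac: "a \<in> carrier R" using a ideal.Icarr by fastforce
  have "a \<otimes> b \<notin> I" using I_prime[OF ac b(1)] a b by auto
  moreover have "a \<otimes> b \<in> K" using ideal.I_r_closed[OF K a(1) b(1)] .
  moreover have "a \<otimes> b \<in> L" if "L \<in> Q" for L
    using that insert.prems ideal.I_l_closed[of L R b a] ac b by auto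
  ultimately show ?case using ac b by auto
qed

text \<open>If \<open>x + j\<close> avoids \<open>Q\<close> but lies in the new prime
  \<open>P\<close>, add to \<open>j\<close> a product \<open>a \<otimes> b\<close> outside
  \<open>P\<close>, with \<open>a\<close> in \<open>J\<close> and \<open>b\<close> in every member
  of \<open>Q\<close>. This moves \<open>x + j\<close> out of \<open>P\<close> and changes nothing
  modulo the members of \<open>Q\<close>.\<close>

lemma (in cring) coset_prime_avoidance:
  assumes "finite Q" and prime: "\<And>P. P \<in> Q \<Longrightarrow> primeideal P R"
    and incomparable: "\<And>P P'. P \<in> Q \<Longrightarrow> P' \<in> Q \<Longrightarrow> P \<subseteq> P' \<Longrightarrow> P = P'"
    and x: "x \<in> carrier R" and J: "ideal J R" and "\<And>P. P \<in> Q \<Longrightarrow> \<not> (x \<in> P \<and> J \<subseteq> P)"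
  shows "\<exists>j\<in>J. \<forall>P\<in>Q. x \<oplus> j \<notin> P"
  using assms
proof (induction Q)
  case empty
  then show ?case using additive_subgroup.zero_closed[OF ideal.axioms(1)[OF J]] by auto
next
  case (insert P Q)
  interpret J: ideal J R by fact
  interpret P: primeideal P R using insert.prems by auto
  obtain j where j: "j \<in> J" "\<forall>P\<in>Q. x \<oplus> j \<notin> P" using insert by force
  have jc: "j \<in> carrier R" using j J.Icarr by auto
  show ?case
  proof (cases "x \<oplus> j \<in> P")
    case False
    then show ?thesis using j by auto
  next
    case True
    \<comment> \<open>Otherwise \<open>x = (x + j) - j\<close> would lie in \<open>P\<close>
      together with \<open>J\<close>, which is excluded.\<close>
    have "\<not> J \<subseteq> P"
    proof
      assume "J \<subseteq> P"
      then have "\<ominus> j \<in> P" using j by auto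
      with True have "(x \<oplus> j) \<oplus> \<ominus> j \<in> P" by (rule P.a_closed)
      moreover have "(x \<oplus> j) \<oplus> \<ominus> j = x" using x jc by algebra
      ultimately show False using insert.prems(5)[of P] \<open>J \<subseteq> P\<close> by auto
    qed
    then obtain a where a: "a \<in> J" "a \<notin> P" by auto
    have idQ: "ideal K R" if "K \<in> Q" for K
      using that insert.prems(1)[of K] by (simp add: primeideal.axioms(1))
    \<comment> \<open>Incomparability enters here: an inclusion would force \<open>K = P\<close>,
      but \<open>P\<close> is not in \<open>Q\<close>.\<close>
    have "\<not> K \<subseteq> P" if "K \<in> Q" for K
      using that insert.prems(2)[of K P] insert.hyps by auto
    from P.finite_ideals_not_subset[OF insert.hyps(1) idQ this]
    obtain b where b: "b \<in> carrier R" "b \<notin> P" "\<forall>K\<in>Q. b \<in> K" by auto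
    have ac: "a \<in> carrier R" using a J.Icarr by auto
    have abP: "a \<otimes> b \<notin> P" using P.I_prime[OF ac b(1)] a b by auto
    have ab: "a \<otimes> b \<in> carrier R" using ac b by simp
    have sub: "x \<oplus> j \<in> K" if K: "ideal K R" "x \<oplus> (j \<oplus> a \<otimes> b) \<in> K" "a \<otimes> b \<in> K" for K
    proof -
      interpret K: ideal K R by fact
      have "(x \<oplus> (j \<oplus> a \<otimes> b)) \<oplus> \<ominus> (a \<otimes> b) \<in> K" using K by auto
      moreover have "(x \<oplus> (j \<oplus> a \<otimes> b)) \<oplus> \<ominus> (a \<otimes> b) = x \<oplus> j" using x jc ab by algebra
      ultimately show ?thesis by simp
    qed
    have "x \<oplus> (j \<oplus> a \<otimes> b) \<notin> P"
    proof
      assume "x \<oplus> (j \<oplus> a \<otimes> b) \<in> P"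
      then have "x \<oplus> (j \<oplus> a \<otimes> b) \<oplus> \<ominus> (x \<oplus> j) \<in> P" using True by auto
      moreover have "x \<oplus> (j \<oplus> a \<otimes> b) \<oplus> \<ominus> (x \<oplus> j) = a \<otimes> b" using x jc ab by algebra
      ultimately show False using abP by simp
    qed
    moreover have "x \<oplus> (j \<oplus> a \<otimes> b) \<notin> K" if "K \<in> Q" for K
      using that sub[OF idQ[OF that]] j b ideal.I_l_closed[OF idQ[OF that], of b a] ac by auto
    moreover have "j \<oplus> a \<otimes> b \<in> J" using j J.I_r_closed[OF a(1) b(1)] by auto
    ultimately show ?thesis by auto
  qed
qed


section \<open>Finitely generated modules over Noetherian rings\<close>

lemma (in abelian_group) add_left_diff:
  assumes "a \<in> carrier G" "b \<in> carrier G" "c \<in> carrier G"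
  shows "(a \<oplus> b) \<ominus> (a \<oplus> c) = b \<ominus> c"
proof -
  have "(a \<oplus> b) \<ominus> (a \<oplus> c) = (b \<oplus> a) \<oplus> (\<ominus> a \<oplus> \<ominus> c)"
    using assms a_comm[of a b] by (simp add: a_minus_def minus_add)
  also have "\<dots> = b \<ominus> c"
    using assms by (simp add: a_minus_def a_assoc r_neg2)
  finally show ?thesis .
qed

lemma (in abelian_group) diff_add_cancel:
  assumes "a \<in> carrier G" "b \<in> carrier G"
  shows "(a \<ominus> b) \<oplus> b = a"
  using assms by (simp add: a_minus_def a_assoc l_neg)

context module
begin

lemma smult_left_commute:
  assumes "a \<in> carrier R" "b \<in> carrier R" "z \<in> carrier M"
  shows "a \<odot>\<^bsub>M\<^esub> (b \<odot>\<^bsub>M\<^esub> z) = b \<odot>\<^bsub>M\<^esub> (a \<odot>\<^bsub>M\<^esub> z)"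
  using smult_assoc1[OF assms] smult_assoc1[OF assms(2,1,3)] R.m_comm[OF assms(1,2)] by metis

lemma submodule_zero: "submodule N R M \<Longrightarrow> \<zero>\<^bsub>M\<^esub> \<in> N"
  by (drule submodule.axioms(1), drule subgroup.one_closed) simp

lemma submodule_diff:
  assumes "submodule N R M" "a \<in> N" "b \<in> N"
  shows "a \<ominus>\<^bsub>M\<^esub> b \<in> N"
  using submoduleE(3,5)[OF assms(1)] assms by (simp add: a_minus_def)

lemma submodule_add_left_iff:
  assumes "submodule N R M" "a \<in> N" "b \<in> carrier M"
  shows "a \<oplus>\<^bsub>M\<^esub> b \<in> N \<longleftrightarrow> b \<in> N"
proof
  have a: "a \<in> carrier M" using assms submoduleE(1) by blast
  assume "a \<oplus>\<^bsub>M\<^esub> b \<in> N"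
  then have "\<ominus>\<^bsub>M\<^esub> a \<oplus>\<^bsub>M\<^esub> (a \<oplus>\<^bsub>M\<^esub> b) \<in> N" using assms submoduleE(3,5) by blast
  then show "b \<in> N" using a assms(3) by (simp add: M.r_neg1)
qed (use assms submoduleE(5) in blast)

section \<open>Spans and finite generation of submodules\<close>

lemma module_span_submodule:
  assumes "A \<subseteq> carrier M"
  shows "submodule (module_span R M A) R M"
proof (rule submoduleI)
  show "module_span R M A \<subseteq> carrier M"
    using assms carrier_is_submodule by (auto simp: module_span_def)
qed (auto simp: module_span_def submodule_zero submoduleE(3-5))

lemma module_span_superset: "A \<subseteq> module_span R M A"
  by (auto simp: module_span_def)

lemma module_span_minimal: "submodule H R M \<Longrightarrow> A \<subseteq> H \<Longrightarrow> module_span R M A \<subseteq> H"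
  by (auto simp: module_span_def)

lemma module_span_mono:
  "A \<subseteq> module_span R M B \<Longrightarrow> B \<subseteq> carrier M \<Longrightarrow> module_span R M A \<subseteq> module_span R M B"
  by (intro module_span_minimal module_span_submodule)

lemma module_span_insert:
  assumes "b \<in> carrier M" "B \<subseteq> carrier M" "z \<in> module_span R M (insert b B)"
  shows "\<exists>r\<in>carrier R. \<exists>s\<in>module_span R M B. z = r \<odot>\<^bsub>M\<^esub> b \<oplus>\<^bsub>M\<^esub> s"
proof -
  let ?S = "module_span R M B"
  note S = module_span_submodule[OF assms(2)]
  note SE = submoduleE[OF S] and S0 = submodule_zero[OF S]
  let ?H = "{z. \<exists>r\<in>carrier R. \<exists>s\<in>?S. z = r \<odot>\<^bsub>M\<^esub> b \<oplus>\<^bsub>M\<^esub> s}"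
  have H: "submodule ?H R M"
  proof (rule submoduleI)
    show "\<zero>\<^bsub>M\<^esub> \<in> ?H" using S0 assms(1) by (auto intro!: bexI[of _ \<zero>] bexI[of _ "\<zero>\<^bsub>M\<^esub>"])
  next
    fix z assume "z \<in> ?H"
    then obtain r s where rs: "r \<in> carrier R" "s \<in> ?S" "z = r \<odot>\<^bsub>M\<^esub> b \<oplus>\<^bsub>M\<^esub> s" by auto
    then have "\<ominus>\<^bsub>M\<^esub> z = (\<ominus> r) \<odot>\<^bsub>M\<^esub> b \<oplus>\<^bsub>M\<^esub> \<ominus>\<^bsub>M\<^esub> s"
      using SE(1) assms(1) by (auto simp: smult_l_minus M.minus_add)
    then show "\<ominus>\<^bsub>M\<^esub> z \<in> ?H" using rs SE(3) by blast
  next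
    fix y z assume "y \<in> ?H" "z \<in> ?H"
    then obtain r s r' s' where rs: "r \<in> carrier R" "s \<in> ?S" "y = r \<odot>\<^bsub>M\<^esub> b \<oplus>\<^bsub>M\<^esub> s"
      "r' \<in> carrier R" "s' \<in> ?S" "z = r' \<odot>\<^bsub>M\<^esub> b \<oplus>\<^bsub>M\<^esub> s'" by auto
    have "s \<in> carrier M" "s' \<in> carrier M" using rs SE(1) by auto
    then have "y \<oplus>\<^bsub>M\<^esub> z = (r \<oplus> r') \<odot>\<^bsub>M\<^esub> b \<oplus>\<^bsub>M\<^esub> (s \<oplus>\<^bsub>M\<^esub> s')"
      using rs assms(1) by (simp add: smult_l_distr M.a_ac)
    then show "y \<oplus>\<^bsub>M\<^esub> z \<in> ?H" using rs SE(5) by blast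
  next
    fix a z assume a: "a \<in> carrier R" and "z \<in> ?H"
    then obtain r s where rs: "r \<in> carrier R" "s \<in> ?S" "z = r \<odot>\<^bsub>M\<^esub> b \<oplus>\<^bsub>M\<^esub> s" by auto
    have "s \<in> carrier M" using rs SE(1) by auto
    then have "a \<odot>\<^bsub>M\<^esub> z = (a \<otimes> r) \<odot>\<^bsub>M\<^esub> b \<oplus>\<^bsub>M\<^esub> a \<odot>\<^bsub>M\<^esub> s"
      using rs a assms(1) by (simp add: smult_r_distr smult_assoc1)
    then show "a \<odot>\<^bsub>M\<^esub> z \<in> ?H" using rs a SE(4) by blast
  qed (use SE(1) assms(1) in auto)
  have "b = \<one> \<odot>\<^bsub>M\<^esub> b \<oplus>\<^bsub>M\<^esub> \<zero>\<^bsub>M\<^esub>" using assms(1) by simp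
  then have "b \<in> ?H" using S0 by blast
  moreover have "B \<subseteq> ?H"
  proof
    fix s assume "s \<in> B"
    then have "s \<in> ?S" using module_span_superset by auto
    moreover from this have "s = \<zero> \<odot>\<^bsub>M\<^esub> b \<oplus>\<^bsub>M\<^esub> s" using assms(1) SE(1) by auto
    ultimately show "s \<in> ?H" by blast
  qed
  ultimately have "module_span R M (insert b B) \<subseteq> ?H" by (intro module_span_minimal H) auto
  then show ?thesis using assms(3) by auto
qed

text \<open>The analogue of an ideal of leading coefficients: the coefficients at \<open>b\<close>
  of elements of \<open>H\<close>, with the tail in \<open>S\<close> left free.\<close>

lemma leading_coeff_ideal:
  assumes H: "submodule H R M" and S: "submodule S R M" and b: "b \<in> carrier M"
  shows "ideal {r \<in> carrier R. \<exists>s\<in>S. r \<odot>\<^bsub>M\<^esub> b \<oplus>\<^bsub>M\<^esub> s \<in> H} R"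
proof (rule R.cidealI)
  show "\<zero> \<in> {r \<in> carrier R. \<exists>s\<in>S. r \<odot>\<^bsub>M\<^esub> b \<oplus>\<^bsub>M\<^esub> s \<in> H}"
    using submodule_zero[OF H] submodule_zero[OF S] b by (auto intro!: bexI[of _ "\<zero>\<^bsub>M\<^esub>"])
next
  fix r r' assume "r \<in> {r \<in> carrier R. \<exists>s\<in>S. r \<odot>\<^bsub>M\<^esub> b \<oplus>\<^bsub>M\<^esub> s \<in> H}"
    "r' \<in> {r \<in> carrier R. \<exists>s\<in>S. r \<odot>\<^bsub>M\<^esub> b \<oplus>\<^bsub>M\<^esub> s \<in> H}"
  then obtain s s' where s: "s \<in> S" "s' \<in> S" "r \<odot>\<^bsub>M\<^esub> b \<oplus>\<^bsub>M\<^esub> s \<in> H" "r' \<odot>\<^bsub>M\<^esub> b \<oplus>\<^bsub>M\<^esub> s' \<in> H"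
    and r: "r \<in> carrier R" "r' \<in> carrier R" by auto
  have "s \<in> carrier M" "s' \<in> carrier M" using s submoduleE(1)[OF S] by auto
  then have "(r \<oplus> r') \<odot>\<^bsub>M\<^esub> b \<oplus>\<^bsub>M\<^esub> (s \<oplus>\<^bsub>M\<^esub> s')
      = (r \<odot>\<^bsub>M\<^esub> b \<oplus>\<^bsub>M\<^esub> s) \<oplus>\<^bsub>M\<^esub> (r' \<odot>\<^bsub>M\<^esub> b \<oplus>\<^bsub>M\<^esub> s')"
    using r b by (simp add: smult_l_distr M.a_ac)
  then have "(r \<oplus> r') \<odot>\<^bsub>M\<^esub> b \<oplus>\<^bsub>M\<^esub> (s \<oplus>\<^bsub>M\<^esub> s') \<in> H" using s submoduleE(5)[OF H] by simp
  then show "r \<oplus> r' \<in> {r \<in> carrier R. \<exists>s\<in>S. r \<odot>\<^bsub>M\<^esub> b \<oplus>\<^bsub>M\<^esub> s \<in> H}"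
    using r s submoduleE(5)[OF S] by blast
next
  fix r a assume "r \<in> {r \<in> carrier R. \<exists>s\<in>S. r \<odot>\<^bsub>M\<^esub> b \<oplus>\<^bsub>M\<^esub> s \<in> H}" and a: "a \<in> carrier R"
  then obtain s where s: "s \<in> S" "r \<odot>\<^bsub>M\<^esub> b \<oplus>\<^bsub>M\<^esub> s \<in> H" and r: "r \<in> carrier R" by auto
  have "s \<in> carrier M" using s submoduleE(1)[OF S] by auto
  then have "(a \<otimes> r) \<odot>\<^bsub>M\<^esub> b \<oplus>\<^bsub>M\<^esub> a \<odot>\<^bsub>M\<^esub> s = a \<odot>\<^bsub>M\<^esub> (r \<odot>\<^bsub>M\<^esub> b \<oplus>\<^bsub>M\<^esub> s)"
    using r b a by (simp add: smult_r_distr smult_assoc1)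
  then have "(a \<otimes> r) \<odot>\<^bsub>M\<^esub> b \<oplus>\<^bsub>M\<^esub> a \<odot>\<^bsub>M\<^esub> s \<in> H" using s a submoduleE(4)[OF H] by simp
  then show "a \<otimes> r \<in> {r \<in> carrier R. \<exists>s\<in>S. r \<odot>\<^bsub>M\<^esub> b \<oplus>\<^bsub>M\<^esub> s \<in> H}"
    using r a s submoduleE(4)[OF S] by blast
qed auto

lemma submodule_Int:
  assumes H: "submodule H R M" and S: "submodule S R M"
  shows "submodule (H \<inter> S) R M"
proof (rule submoduleI)
  show "H \<inter> S \<subseteq> carrier M" using submoduleE(1)[OF H] by blast
qed (use submodule_zero[OF H] submodule_zero[OF S] submoduleE(3-5)[OF H] submoduleE(3-5)[OF S] in simp_all)

text \<open>Induction on \<open>B\<close>: lift finitely many generators of the ideal of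
  coefficients at \<open>b\<close> to elements of \<open>H\<close>, and join them with finitely many
  elements that take care of the part of \<open>H\<close> in the span of the other
  generators.\<close>

lemma submodule_finitely_generated:
  assumes noeth: "noetherian_ring R"
    and "finite B" "B \<subseteq> carrier M" "submodule H R M" "H \<subseteq> module_span R M B"
  shows "\<exists>A\<subseteq>H. finite A \<and> H \<subseteq> module_span R M A"
  using assms(2-)
proof (induction B arbitrary: H)
  case empty
  then show ?case by auto
next
  case (insert b B)
  note H = insert.prems(2)
  note HE = submoduleE[OF H]
  have b: "b \<in> carrier M" and B: "B \<subseteq> carrier M" using insert.prems by auto
  let ?S = "module_span R M B"
  note S = module_span_submodule[OF B]
  let ?J = "\<lambda>H. {r \<in> carrier R. \<exists>s\<in>?S. r \<odot>\<^bsub>M\<^esub> b \<oplus>\<^bsub>M\<^esub> s \<in> H}"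
  obtain A0 where A0: "A0 \<subseteq> carrier R" "finite A0" "?J H = Idl A0"
    using noetherian_ring.finetely_gen[OF noeth leading_coeff_ideal[OF H S b]] by auto
  have "A0 \<subseteq> ?J H" using R.genideal_self[OF A0(1)] A0(3) by simp
  then have "\<forall>a\<in>A0. \<exists>s\<in>?S. a \<odot>\<^bsub>M\<^esub> b \<oplus>\<^bsub>M\<^esub> s \<in> H" by auto
  then obtain s where s: "\<And>a. a \<in> A0 \<Longrightarrow> s a \<in> ?S" "\<And>a. a \<in> A0 \<Longrightarrow> a \<odot>\<^bsub>M\<^esub> b \<oplus>\<^bsub>M\<^esub> s a \<in> H" by metis
  obtain A1 where A1: "A1 \<subseteq> H \<inter> ?S" "finite A1" "H \<inter> ?S \<subseteq> module_span R M A1"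
    using insert.IH[OF B submodule_Int[OF H S]] by auto
  define A where "A = A1 \<union> (\<lambda>a. a \<odot>\<^bsub>M\<^esub> b \<oplus>\<^bsub>M\<^esub> s a) ` A0"
  have A: "A \<subseteq> H" "finite A" using A1 A0 s by (auto simp: A_def)
  then have Ac: "A \<subseteq> carrier M" using HE by auto
  note AS = module_span_submodule[OF Ac]
  have "A0 \<subseteq> ?J (module_span R M A)"
  proof
    fix a assume a: "a \<in> A0"
    then have "a \<odot>\<^bsub>M\<^esub> b \<oplus>\<^bsub>M\<^esub> s a \<in> module_span R M A"
      using module_span_superset[of A] unfolding A_def by blast
    then show "a \<in> ?J (module_span R M A)" using a A0(1) s(1) by blast
  qed
  \<comment> \<open>The coefficients at \<open>b\<close> occurring in the span of \<open>A\<close>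
    form an ideal containing \<open>A0\<close>, hence include all those occurring in
    \<open>H\<close>.\<close>
  from R.genideal_minimal[OF leading_coeff_ideal[OF AS S b] this]
  have J: "?J H \<subseteq> ?J (module_span R M A)" unfolding A0(3) .
  have "z \<in> module_span R M A" if z: "z \<in> H" for z
  proof -
    obtain r t where rt: "r \<in> carrier R" "t \<in> ?S" "z = r \<odot>\<^bsub>M\<^esub> b \<oplus>\<^bsub>M\<^esub> t"
      using module_span_insert[OF b B] insert.prems z by blast
    then have "r \<in> ?J H" using z by blast
    then obtain u where u: "u \<in> ?S" "r \<odot>\<^bsub>M\<^esub> b \<oplus>\<^bsub>M\<^esub> u \<in> module_span R M A" using J by blast
    have uH: "r \<odot>\<^bsub>M\<^esub> b \<oplus>\<^bsub>M\<^esub> u \<in> H" using u(2) module_span_minimal[OF H A(1)] by auto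
    have c: "t \<in> carrier M" "u \<in> carrier M" "r \<odot>\<^bsub>M\<^esub> b \<in> carrier M"
      using rt u submoduleE(1)[OF S] b by auto
    \<comment> \<open>Equal coefficients at \<open>b\<close> cancel, so the difference falls into
      the part of \<open>H\<close> covered by \<open>A1\<close>.\<close>
    have eq: "z \<ominus>\<^bsub>M\<^esub> (r \<odot>\<^bsub>M\<^esub> b \<oplus>\<^bsub>M\<^esub> u) = t \<ominus>\<^bsub>M\<^esub> u"
      unfolding rt(3) using c by (intro M.add_left_diff)
    have "t \<ominus>\<^bsub>M\<^esub> u \<in> H \<inter> ?S"
      using submodule_diff[OF H z uH] eq submodule_diff[OF S rt(2) u(1)] by simp
    also have "\<dots> \<subseteq> module_span R M A"
      using A1(3) module_span_mono[of A1 A] module_span_superset[of A] Ac by (auto simp: A_def)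
    finally have "z \<ominus>\<^bsub>M\<^esub> (r \<odot>\<^bsub>M\<^esub> b \<oplus>\<^bsub>M\<^esub> u) \<in> module_span R M A" unfolding eq .
    then have "(z \<ominus>\<^bsub>M\<^esub> (r \<odot>\<^bsub>M\<^esub> b \<oplus>\<^bsub>M\<^esub> u)) \<oplus>\<^bsub>M\<^esub> (r \<odot>\<^bsub>M\<^esub> b \<oplus>\<^bsub>M\<^esub> u) \<in> module_span R M A"
      using u(2) submoduleE(5)[OF AS] by blast
    then show ?thesis using M.diff_add_cancel c z HE(1) by (simp add: subset_iff)
  qed
  then show ?case using A by auto
qed

text \<open>The spans of the finite subsets of \<open>T\<close> have a submodule as their union.
  This selects finitely many generators from the prescribed set \<open>T\<close> itself.\<close>

lemma module_span_finitary:
  assumes T: "T \<subseteq> carrier M" and "finite A" "A \<subseteq> module_span R M T"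
  shows "\<exists>T0\<subseteq>T. finite T0 \<and> A \<subseteq> module_span R M T0"
proof -
  let ?U = "{z. \<exists>T0\<subseteq>T. finite T0 \<and> z \<in> module_span R M T0}"
  have sm: "submodule (module_span R M T0) R M" if "T0 \<subseteq> T" for T0
    using that T by (intro module_span_submodule) auto
  have mono: "module_span R M T0 \<subseteq> module_span R M T1" if "T0 \<subseteq> T1" "T1 \<subseteq> T" for T0 T1
    using that T module_span_superset[of T1] by (intro module_span_mono) auto
  have "submodule ?U R M"
  proof (rule submoduleI)
    show "?U \<subseteq> carrier M" using submoduleE(1)[OF sm] by blast
    show "\<zero>\<^bsub>M\<^esub> \<in> ?U" using submodule_zero[OF sm[of "{}"]] by auto
  next
    fix y z assume "y \<in> ?U" "z \<in> ?U"
    then obtain S0 S1 where S: "S0 \<subseteq> T" "finite S0" "y \<in> module_span R M S0"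
      "S1 \<subseteq> T" "finite S1" "z \<in> module_span R M S1" by auto
    then have "y \<oplus>\<^bsub>M\<^esub> z \<in> module_span R M (S0 \<union> S1)"
      using submoduleE(5)[OF sm[of "S0 \<union> S1"]] mono[of S0 "S0 \<union> S1"] mono[of S1 "S0 \<union> S1"] by blast
    then show "y \<oplus>\<^bsub>M\<^esub> z \<in> ?U" using S by (intro CollectI exI[of _ "S0 \<union> S1"]) auto
  qed (use submoduleE(3,4)[OF sm] in blast)+
  moreover have "T \<subseteq> ?U"
  proof
    fix t assume "t \<in> T"
    then show "t \<in> ?U" using module_span_superset[of "{t}"] by (intro CollectI exI[of _ "{t}"]) auto
  qed
  ultimately have "A \<subseteq> ?U" using module_span_minimal[of ?U T] assms(3) by auto
  then have "\<forall>a\<in>A. \<exists>T0\<subseteq>T. finite T0 \<and> a \<in> module_span R M T0" by auto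
  then obtain f where f: "\<And>a. a \<in> A \<Longrightarrow> f a \<subseteq> T \<and> finite (f a) \<and> a \<in> module_span R M (f a)" by metis
  have "a \<in> module_span R M (\<Union>(f ` A))" if "a \<in> A" for a
    using that f mono[of "f a" "\<Union>(f ` A)"] by blast
  then show ?thesis using f assms(2) by (intro exI[of _ "\<Union>(f ` A)"]) auto
qed


section \<open>Regular elements in a coset\<close>

text \<open>The annihilator of the class of \<open>z\<close> in \<open>M / N\<close>, expressed
  inside \<open>M\<close>.\<close>

definition annihilator_mod :: "'c set \<Rightarrow> 'c \<Rightarrow> 'a set" where
  "annihilator_mod N z = {r \<in> carrier R. r \<odot>\<^bsub>M\<^esub> z \<in> N}"

lemma annihilator_mod_ideal:
  assumes N: "submodule N R M" and z: "z \<in> carrier M"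
  shows "ideal (annihilator_mod N z) R"
  using z submoduleE(4)[OF N] submoduleE(5)[OF N] submodule_zero[OF N]
  by (intro R.cidealI) (auto simp: annihilator_mod_def smult_l_distr smult_assoc1)

text \<open>Over a Noetherian ring, the annihilators of these elements are the maximal associated
  primes of \<open>M / N\<close>. Elements are collected instead of ideals because finiteness comes
  from the submodule that they span.\<close>

definition maximal_annihilators :: "'c set \<Rightarrow> 'c set" where
  "maximal_annihilators N = {z \<in> carrier M - N. \<forall>w \<in> carrier M - N.
     annihilator_mod N z \<subseteq> annihilator_mod N w \<longrightarrow> annihilator_mod N w = annihilator_mod N z}"

text \<open>If \<open>b\<close> does not kill the class of \<open>z\<close>, the annihilator of
  \<open>b z\<close> contains that of \<open>z\<close>, so maximality makes them equal;
  \<open>a\<close> kills \<open>b z\<close> and hence \<open>z\<close>.\<close>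

lemma maximal_annihilator_prime:
  assumes N: "submodule N R M" and z: "z \<in> maximal_annihilators N"
  shows "primeideal (annihilator_mod N z) R"
proof (rule primeidealI)
  have zc: "z \<in> carrier M" "z \<notin> N" using z by (auto simp: maximal_annihilators_def)
  show "ideal (annihilator_mod N z) R" by (rule annihilator_mod_ideal[OF N zc(1)])
  have "\<one> \<notin> annihilator_mod N z" using zc by (simp add: annihilator_mod_def)
  then show "carrier R \<noteq> annihilator_mod N z" by auto
  fix a b assume ab: "a \<in> carrier R" "b \<in> carrier R" "a \<otimes> b \<in> annihilator_mod N z"
  show "a \<in> annihilator_mod N z \<or> b \<in> annihilator_mod N z"
  proof (cases "b \<odot>\<^bsub>M\<^esub> z \<in> N")
    case False
    have "annihilator_mod N z \<subseteq> annihilator_mod N (b \<odot>\<^bsub>M\<^esub> z)"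
    proof
      fix r assume "r \<in> annihilator_mod N z"
      then have r: "r \<in> carrier R" "r \<odot>\<^bsub>M\<^esub> z \<in> N" by (auto simp: annihilator_mod_def)
      have "r \<odot>\<^bsub>M\<^esub> (b \<odot>\<^bsub>M\<^esub> z) = b \<odot>\<^bsub>M\<^esub> (r \<odot>\<^bsub>M\<^esub> z)"
        by (rule smult_left_commute[OF r(1) ab(2) zc(1)])
      then show "r \<in> annihilator_mod N (b \<odot>\<^bsub>M\<^esub> z)"
        using r ab submoduleE(4)[OF N] by (simp add: annihilator_mod_def)
    qed
    then have "annihilator_mod N (b \<odot>\<^bsub>M\<^esub> z) = annihilator_mod N z"
      using z zc ab False by (simp add: maximal_annihilators_def)
    moreover have "a \<in> annihilator_mod N (b \<odot>\<^bsub>M\<^esub> z)"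
      using ab zc by (simp add: annihilator_mod_def smult_assoc1)
    ultimately show ?thesis by simp
  qed (use ab in \<open>simp add: annihilator_mod_def\<close>)
qed (rule R.is_cring)

text \<open>Finitely many elements \<open>T0\<close> span all the others. If no annihilator of an
  element of \<open>T0\<close> were contained in the prime annihilator of \<open>z\<close>, some
  \<open>b\<close> outside that prime would kill \<open>T0\<close> and hence \<open>z\<close>. An
  inclusion is an equality by maximality.\<close>

lemma finite_maximal_annihilators:
  assumes noeth: "noetherian_ring R" and fg: "finitely_generated_module R M"
    and N: "submodule N R M"
  shows "finite (annihilator_mod N ` maximal_annihilators N)"
proof -
  let ?T = "maximal_annihilators N"
  have T: "?T \<subseteq> carrier M" by (auto simp: maximal_annihilators_def)
  obtain B where B: "finite B" "B \<subseteq> carrier M" "module_span R M B = carrier M"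
    using fg by (auto simp: finitely_generated_module_def)
  note S = module_span_submodule[OF T]
  obtain A where A: "A \<subseteq> module_span R M ?T" "finite A" "module_span R M ?T \<subseteq> module_span R M A"
    using submodule_finitely_generated[OF noeth B(1,2) S] submoduleE(1)[OF S] B(3) by auto
  obtain T0 where T0: "T0 \<subseteq> ?T" "finite T0" "A \<subseteq> module_span R M T0"
    using module_span_finitary[OF T A(2,1)] by auto
  have T0c: "T0 \<subseteq> carrier M" using T0 T by auto
  have TT0: "?T \<subseteq> module_span R M T0"
    using A(3) module_span_mono[OF T0(3) T0c] module_span_superset[of ?T] by auto
  have "annihilator_mod N z \<in> annihilator_mod N ` T0" if z: "z \<in> ?T" for z
  proof -
    note P = maximal_annihilator_prime[OF N z]
    have "\<exists>t\<in>T0. annihilator_mod N t \<subseteq> annihilator_mod N z"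
    proof (rule ccontr)
      assume "\<not> ?thesis"
      then have "\<exists>b\<in>carrier R. b \<notin> annihilator_mod N z \<and> (\<forall>K\<in>annihilator_mod N ` T0. b \<in> K)"
        using annihilator_mod_ideal[OF N] T0(2) T0c
        by (intro primeideal.finite_ideals_not_subset[OF P] finite_imageI) blast+
      then obtain b where b: "b \<in> carrier R" "b \<notin> annihilator_mod N z"
        and bT0: "\<And>t. t \<in> T0 \<Longrightarrow> b \<in> annihilator_mod N t" by blast
      have bN: "b \<odot>\<^bsub>M\<^esub> t \<in> N" if "t \<in> T0" for t
        using bT0[OF that] unfolding annihilator_mod_def by blast
      have "submodule {w \<in> carrier M. b \<odot>\<^bsub>M\<^esub> w \<in> N} R M"
      proof (rule submoduleI)
        show "\<ominus>\<^bsub>M\<^esub> a \<in> {w \<in> carrier M. b \<odot>\<^bsub>M\<^esub> w \<in> N}" if "a \<in> {w \<in> carrier M. b \<odot>\<^bsub>M\<^esub> w \<in> N}" for a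
          using that b submoduleE(3)[OF N] by (simp add: smult_r_minus)
        show "a \<oplus>\<^bsub>M\<^esub> a' \<in> {w \<in> carrier M. b \<odot>\<^bsub>M\<^esub> w \<in> N}"
          if "a \<in> {w \<in> carrier M. b \<odot>\<^bsub>M\<^esub> w \<in> N}" "a' \<in> {w \<in> carrier M. b \<odot>\<^bsub>M\<^esub> w \<in> N}" for a a'
          using that b submoduleE(5)[OF N] by (simp add: smult_r_distr)
        fix a x assume a: "a \<in> carrier R" and x: "x \<in> {w \<in> carrier M. b \<odot>\<^bsub>M\<^esub> w \<in> N}"
        then have "b \<odot>\<^bsub>M\<^esub> (a \<odot>\<^bsub>M\<^esub> x) = a \<odot>\<^bsub>M\<^esub> (b \<odot>\<^bsub>M\<^esub> x)"
          using b by (intro smult_left_commute) auto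
        then show "a \<odot>\<^bsub>M\<^esub> x \<in> {w \<in> carrier M. b \<odot>\<^bsub>M\<^esub> w \<in> N}"
          using a x submoduleE(4)[OF N] by auto
      qed (use b submodule_zero[OF N] in auto)
      from module_span_minimal[OF this, of T0] have "b \<odot>\<^bsub>M\<^esub> z \<in> N" using bN T0c TT0 z by blast
      then show False using b by (simp add: annihilator_mod_def)
    qed
    then obtain t where t: "t \<in> T0" "annihilator_mod N t \<subseteq> annihilator_mod N z" by blast
    then have "annihilator_mod N z = annihilator_mod N t"
      using z T0(1) unfolding maximal_annihilators_def by blast
    then show ?thesis using t by blast
  qed
  then have "annihilator_mod N ` ?T \<subseteq> annihilator_mod N ` T0" by (rule image_subsetI)
  then show ?thesis by (rule finite_subset) (rule finite_imageI[OF T0(2)])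
qed

text \<open>By \<open>socle\<close>, no maximal annihilator contains both \<open>x\<close> and
  \<open>J\<close>, so some \<open>x + j\<close> avoids them all. Anything that kills a nonzero
  class of \<open>M / N\<close> lies in a maximal annihilator, so avoidance amounts to
  regularity.\<close>

lemma regular_element_in_coset:
  assumes noeth: "noetherian_ring R" and fg: "finitely_generated_module R M"
    and N: "submodule N R M" and x: "x \<in> carrier R" and J: "ideal J R"
    and socle: "\<And>z. z \<in> carrier M \<Longrightarrow> x \<odot>\<^bsub>M\<^esub> z \<in> N \<Longrightarrow> (\<forall>j\<in>J. j \<odot>\<^bsub>M\<^esub> z \<in> N) \<Longrightarrow> z \<in> N"
  shows "\<exists>j\<in>J. \<forall>z\<in>carrier M. (x \<oplus> j) \<odot>\<^bsub>M\<^esub> z \<in> N \<longrightarrow> z \<in> N"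
proof -
  interpret J: ideal J R by fact
  have "\<exists>j\<in>J. \<forall>P\<in>annihilator_mod N ` maximal_annihilators N. x \<oplus> j \<notin> P"
  proof (rule R.coset_prime_avoidance[OF finite_maximal_annihilators[OF noeth fg N] _ _ x J])
    fix P assume "P \<in> annihilator_mod N ` maximal_annihilators N"
    then obtain z where z: "z \<in> maximal_annihilators N" "P = annihilator_mod N z" by auto
    then show "primeideal P R" using maximal_annihilator_prime[OF N] by auto
    have zc: "z \<in> carrier M" "z \<notin> N" using z(1) unfolding maximal_annihilators_def by blast+
    show "\<not> (x \<in> P \<and> J \<subseteq> P)"
    proof
      assume "x \<in> P \<and> J \<subseteq> P"
      then have "x \<odot>\<^bsub>M\<^esub> z \<in> N" "\<forall>j\<in>J. j \<odot>\<^bsub>M\<^esub> z \<in> N"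
        unfolding z(2) annihilator_mod_def by blast+
      then show False using socle zc by blast
    qed
  next
    fix P P' assume "P \<in> annihilator_mod N ` maximal_annihilators N"
      "P' \<in> annihilator_mod N ` maximal_annihilators N" "P \<subseteq> P'"
    then show "P = P'" unfolding maximal_annihilators_def by blast
  qed
  then obtain j where j: "j \<in> J" "\<And>z. z \<in> maximal_annihilators N \<Longrightarrow> x \<oplus> j \<notin> annihilator_mod N z" by auto
  have "z \<in> N" if z: "z \<in> carrier M" "(x \<oplus> j) \<odot>\<^bsub>M\<^esub> z \<in> N" for z
  proof (rule ccontr)
    assume zN: "z \<notin> N"
    have id: "ideal I R" if "I \<in> annihilator_mod N ` (carrier M - N)" for I
      using that annihilator_mod_ideal[OF N] by auto
    have "annihilator_mod N z \<in> annihilator_mod N ` (carrier M - N)" using z zN by auto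
    from noetherian_ring.maximal_member[OF noeth id this] obtain w
      where w: "w \<in> maximal_annihilators N" "annihilator_mod N z \<subseteq> annihilator_mod N w"
      by (auto simp: maximal_annihilators_def)
    have "x \<oplus> j \<in> annihilator_mod N z" using z x j(1) J.Icarr by (auto simp: annihilator_mod_def)
    then show False using w j(2) by auto
  qed
  then show ?thesis using j by auto
qed

end


section \<open>Homomorphisms from free modules\<close>

context module
begin

lemma submoduleI':
  assumes "H \<subseteq> carrier M" "\<zero>\<^bsub>M\<^esub> \<in> H" "\<And>a b. a \<in> H \<Longrightarrow> b \<in> H \<Longrightarrow> a \<oplus>\<^bsub>M\<^esub> b \<in> H"
    and "\<And>a x. a \<in> carrier R \<Longrightarrow> x \<in> H \<Longrightarrow> a \<odot>\<^bsub>M\<^esub> x \<in> H"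
  shows "submodule H R M"
proof (rule submoduleI[OF assms(1,2) _ assms(3,4)])
  fix a assume a: "a \<in> H"
  then have "\<ominus>\<^bsub>M\<^esub> a = (\<ominus> \<one>) \<odot>\<^bsub>M\<^esub> a" using assms(1) by (subst smult_l_minus) auto
  then show "\<ominus>\<^bsub>M\<^esub> a \<in> H" using assms(4)[OF _ a, of "\<ominus> \<one>"] by simp
qed

lemma mod_hom_closed: "h \<in> mod_hom R F M \<Longrightarrow> x \<in> carrier F \<Longrightarrow> h x \<in> carrier M"
  by (auto simp: mod_hom_def)

lemma mod_hom_add:
  "h \<in> mod_hom R F M \<Longrightarrow> x \<in> carrier F \<Longrightarrow> y \<in> carrier F \<Longrightarrow> h (x \<oplus>\<^bsub>F\<^esub> y) = h x \<oplus>\<^bsub>M\<^esub> h y"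
  by (auto simp: mod_hom_def)

lemma mod_hom_smult:
  "h \<in> mod_hom R F M \<Longrightarrow> r \<in> carrier R \<Longrightarrow> x \<in> carrier F \<Longrightarrow> h (r \<odot>\<^bsub>F\<^esub> x) = r \<odot>\<^bsub>M\<^esub> h x"
  by (auto simp: mod_hom_def)

lemma mod_hom_zero:
  assumes "module R F" "h \<in> mod_hom R F M"
  shows "h \<zero>\<^bsub>F\<^esub> = \<zero>\<^bsub>M\<^esub>"
proof -
  interpret F: module R F by fact
  have "h \<zero>\<^bsub>F\<^esub> = h (\<zero> \<odot>\<^bsub>F\<^esub> \<zero>\<^bsub>F\<^esub>)" by simp
  also have "\<dots> = \<zero> \<odot>\<^bsub>M\<^esub> h \<zero>\<^bsub>F\<^esub>" using assms(2) by (intro mod_hom_smult) auto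
  also have "\<dots> = \<zero>\<^bsub>M\<^esub>" using mod_hom_closed[OF assms(2)] by simp
  finally show ?thesis .
qed

lemma mod_hom_diff_smult:
  assumes "module R F" and f: "f \<in> mod_hom R F M" and g: "g \<in> mod_hom R F M" and y: "y \<in> carrier R"
  shows "(\<lambda>x\<in>carrier F. f x \<ominus>\<^bsub>M\<^esub> y \<odot>\<^bsub>M\<^esub> g x) \<in> mod_hom R F M"
proof -
  interpret F: module R F by fact
  note cl = mod_hom_closed[OF f] mod_hom_closed[OF g]
  have "(f x \<oplus>\<^bsub>M\<^esub> f x') \<ominus>\<^bsub>M\<^esub> y \<odot>\<^bsub>M\<^esub> (g x \<oplus>\<^bsub>M\<^esub> g x')
      = (f x \<ominus>\<^bsub>M\<^esub> y \<odot>\<^bsub>M\<^esub> g x) \<oplus>\<^bsub>M\<^esub> (f x' \<ominus>\<^bsub>M\<^esub> y \<odot>\<^bsub>M\<^esub> g x')"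
    if "x \<in> carrier F" "x' \<in> carrier F" for x x'
    using that cl y by (simp add: a_minus_def smult_r_distr M.minus_add M.a_ac)
  moreover have "r \<odot>\<^bsub>M\<^esub> f x \<ominus>\<^bsub>M\<^esub> y \<odot>\<^bsub>M\<^esub> (r \<odot>\<^bsub>M\<^esub> g x) = r \<odot>\<^bsub>M\<^esub> (f x \<ominus>\<^bsub>M\<^esub> y \<odot>\<^bsub>M\<^esub> g x)"
    if "x \<in> carrier F" "r \<in> carrier R" for x r
    using that cl y smult_left_commute[of y r "g x"] by (simp add: a_minus_def smult_r_distr smult_r_minus)
  ultimately show ?thesis
    unfolding mod_hom_def
    using cl y mod_hom_add[OF f] mod_hom_add[OF g] mod_hom_smult[OF f] mod_hom_smult[OF g]
    by auto
qed

section \<open>Homomorphisms prescribed on a basis\<close>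

lemma finsum_smult_extend:
  assumes "finite D" "A \<subseteq> D" "c \<in> A \<rightarrow> carrier R" "\<phi> \<in> D \<rightarrow> carrier M"
  shows "(\<Oplus>\<^bsub>M\<^esub>b\<in>A. c b \<odot>\<^bsub>M\<^esub> \<phi> b) = (\<Oplus>\<^bsub>M\<^esub>b\<in>D. (if b \<in> A then c b else \<zero>) \<odot>\<^bsub>M\<^esub> \<phi> b)"
proof (rule M.add.finprod_mono_neutral_cong_left)
  show "(if b \<in> A then c b else \<zero>) \<odot>\<^bsub>M\<^esub> \<phi> b = \<zero>\<^bsub>M\<^esub>" if "b \<in> D - A" for b
    using that assms(4) by (auto simp: Pi_iff)
  show "(\<lambda>b. (if b \<in> A then c b else \<zero>) \<odot>\<^bsub>M\<^esub> \<phi> b) \<in> D \<rightarrow> carrier M"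
    using assms(3,4) by (auto simp: Pi_iff)
qed (use assms in auto)

lemma finsum_smult_add:
  assumes "finite A" "finite A'" "c \<in> A \<rightarrow> carrier R" "c' \<in> A' \<rightarrow> carrier R" "\<phi> \<in> A \<union> A' \<rightarrow> carrier M"
  defines "e \<equiv> \<lambda>b. (if b \<in> A then c b else \<zero>) \<oplus> (if b \<in> A' then c' b else \<zero>)"
  shows "(\<Oplus>\<^bsub>M\<^esub>b\<in>A. c b \<odot>\<^bsub>M\<^esub> \<phi> b) \<oplus>\<^bsub>M\<^esub> (\<Oplus>\<^bsub>M\<^esub>b\<in>A'. c' b \<odot>\<^bsub>M\<^esub> \<phi> b)
    = (\<Oplus>\<^bsub>M\<^esub>b\<in>A \<union> A'. e b \<odot>\<^bsub>M\<^esub> \<phi> b)"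
proof -
  let ?D = "A \<union> A'"
  let ?c = "\<lambda>b. if b \<in> A then c b else \<zero>" and ?c' = "\<lambda>b. if b \<in> A' then c' b else \<zero>"
  have cl: "?c b \<in> carrier R" "?c' b \<in> carrier R" for b using assms by auto
  have "(\<Oplus>\<^bsub>M\<^esub>b\<in>A. c b \<odot>\<^bsub>M\<^esub> \<phi> b) \<oplus>\<^bsub>M\<^esub> (\<Oplus>\<^bsub>M\<^esub>b\<in>A'. c' b \<odot>\<^bsub>M\<^esub> \<phi> b)
      = (\<Oplus>\<^bsub>M\<^esub>b\<in>?D. ?c b \<odot>\<^bsub>M\<^esub> \<phi> b) \<oplus>\<^bsub>M\<^esub> (\<Oplus>\<^bsub>M\<^esub>b\<in>?D. ?c' b \<odot>\<^bsub>M\<^esub> \<phi> b)"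
    using assms finsum_smult_extend[of ?D A c \<phi>] finsum_smult_extend[of ?D A' c' \<phi>] by simp
  also have "\<dots> = (\<Oplus>\<^bsub>M\<^esub>b\<in>?D. ?c b \<odot>\<^bsub>M\<^esub> \<phi> b \<oplus>\<^bsub>M\<^esub> ?c' b \<odot>\<^bsub>M\<^esub> \<phi> b)"
    using assms(5) cl by (intro M.finsum_addf[symmetric] Pi_I smult_closed) (auto simp: Pi_iff)
  also have "\<dots> = (\<Oplus>\<^bsub>M\<^esub>b\<in>?D. e b \<odot>\<^bsub>M\<^esub> \<phi> b)"
  proof (rule M.finsum_cong')
    fix b assume "b \<in> ?D"
    then have "\<phi> b \<in> carrier M" using assms(5) by blast
    then show "?c b \<odot>\<^bsub>M\<^esub> \<phi> b \<oplus>\<^bsub>M\<^esub> ?c' b \<odot>\<^bsub>M\<^esub> \<phi> b = e b \<odot>\<^bsub>M\<^esub> \<phi> b"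
      unfolding e_def by (rule smult_l_distr[symmetric, OF cl])
  next
    show "(\<lambda>b. e b \<odot>\<^bsub>M\<^esub> \<phi> b) \<in> ?D \<rightarrow> carrier M"
      using assms(5) cl unfolding e_def by (intro Pi_I smult_closed R.a_closed) (auto simp: Pi_iff)
  qed simp
  finally show ?thesis .
qed

text \<open>The relation \<open>rel\<close> consists of the linear combinations of the pairs
  \<open>(b, \<phi> b)\<close>; it is total because \<open>B\<close> spans and single-valued because
  \<open>B\<close> is independent. The terms of the chosen resolution are known only to possess such
  a \<open>B\<close>.\<close>

lemma free_basis_hom_exists:
  assumes F: "module R F" and B: "B \<subseteq> carrier F" "module_span R F B = carrier F"
    and indep: "linearly_independent R F B" and \<phi>: "\<phi> \<in> B \<rightarrow> carrier M"
  shows "\<exists>h\<in>mod_hom R F M. \<forall>b\<in>B. h b = \<phi> b"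
proof -
  interpret F: module R F by fact
  define rel where "rel f m \<longleftrightarrow> (\<exists>A c. finite A \<and> A \<subseteq> B \<and> c \<in> A \<rightarrow> carrier R \<and>
    f = (\<Oplus>\<^bsub>F\<^esub>b\<in>A. c b \<odot>\<^bsub>F\<^esub> b) \<and> m = (\<Oplus>\<^bsub>M\<^esub>b\<in>A. c b \<odot>\<^bsub>M\<^esub> \<phi> b))" for f m
  have relE: thesis
    if "rel f m" and "\<And>A c. finite A \<Longrightarrow> A \<subseteq> B \<Longrightarrow> c \<in> A \<rightarrow> carrier R \<Longrightarrow> f = (\<Oplus>\<^bsub>F\<^esub>b\<in>A. c b \<odot>\<^bsub>F\<^esub> b) \<Longrightarrow>
      m = (\<Oplus>\<^bsub>M\<^esub>b\<in>A. c b \<odot>\<^bsub>M\<^esub> \<phi> b) \<Longrightarrow> thesis" for f m thesis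
    using that(1) unfolding rel_def by (elim exE conjE) (rule that(2))
  have relI: "rel (\<Oplus>\<^bsub>F\<^esub>b\<in>A. c b \<odot>\<^bsub>F\<^esub> b) (\<Oplus>\<^bsub>M\<^esub>b\<in>A. c b \<odot>\<^bsub>M\<^esub> \<phi> b)"
    if "finite A" "A \<subseteq> B" "c \<in> A \<rightarrow> carrier R" for A c
    unfolding rel_def using that by blast
  have rel_closed: "f \<in> carrier F" "m \<in> carrier M" if "rel f m" for f m
    using that B(1) \<phi> unfolding rel_def by (auto intro!: F.finsum_closed M.finsum_closed simp: Pi_iff subset_iff)
  have rel_zero: "rel \<zero>\<^bsub>F\<^esub> \<zero>\<^bsub>M\<^esub>" using relI[of "{}" "\<lambda>_. \<zero>"] by simp
  have rel_add: "rel (f \<oplus>\<^bsub>F\<^esub> f') (m \<oplus>\<^bsub>M\<^esub> m')" if r: "rel f m" "rel f' m'" for f f' m m'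
  proof -
    obtain A c where A: "finite A" "A \<subseteq> B" "c \<in> A \<rightarrow> carrier R" "f = (\<Oplus>\<^bsub>F\<^esub>b\<in>A. c b \<odot>\<^bsub>F\<^esub> b)"
      "m = (\<Oplus>\<^bsub>M\<^esub>b\<in>A. c b \<odot>\<^bsub>M\<^esub> \<phi> b)" by (rule relE[OF r(1)])
    obtain A' c' where A': "finite A'" "A' \<subseteq> B" "c' \<in> A' \<rightarrow> carrier R" "f' = (\<Oplus>\<^bsub>F\<^esub>b\<in>A'. c' b \<odot>\<^bsub>F\<^esub> b)"
      "m' = (\<Oplus>\<^bsub>M\<^esub>b\<in>A'. c' b \<odot>\<^bsub>M\<^esub> \<phi> b)" by (rule relE[OF r(2)])
    let ?e = "\<lambda>b. (if b \<in> A then c b else \<zero>) \<oplus> (if b \<in> A' then c' b else \<zero>)"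
    have "f \<oplus>\<^bsub>F\<^esub> f' = (\<Oplus>\<^bsub>F\<^esub>b\<in>A \<union> A'. ?e b \<odot>\<^bsub>F\<^esub> b)"
      unfolding A(4) A'(4) using A A' B(1) by (intro F.finsum_smult_add) auto
    moreover have "m \<oplus>\<^bsub>M\<^esub> m' = (\<Oplus>\<^bsub>M\<^esub>b\<in>A \<union> A'. ?e b \<odot>\<^bsub>M\<^esub> \<phi> b)"
      unfolding A(5) A'(5) using A A' \<phi> by (intro finsum_smult_add) auto
    moreover have "?e \<in> A \<union> A' \<rightarrow> carrier R" using A(3) A'(3) by (auto simp: Pi_iff)
    ultimately show ?thesis using relI[of "A \<union> A'" ?e] A(1,2) A'(1,2) by simp
  qed
  have rel_smult: "rel (r \<odot>\<^bsub>F\<^esub> f) (r \<odot>\<^bsub>M\<^esub> m)" if r: "r \<in> carrier R" "rel f m" for r f m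
  proof -
    obtain A c where A: "finite A" "A \<subseteq> B" "c \<in> A \<rightarrow> carrier R" "f = (\<Oplus>\<^bsub>F\<^esub>b\<in>A. c b \<odot>\<^bsub>F\<^esub> b)"
      "m = (\<Oplus>\<^bsub>M\<^esub>b\<in>A. c b \<odot>\<^bsub>M\<^esub> \<phi> b)" by (rule relE[OF r(2)])
    have cB: "c b \<in> carrier R" "b \<in> carrier F" "\<phi> b \<in> carrier M" if "b \<in> A" for b
      using that A B \<phi> by auto
    have "r \<odot>\<^bsub>F\<^esub> f = (\<Oplus>\<^bsub>F\<^esub>b\<in>A. r \<odot>\<^bsub>F\<^esub> (c b \<odot>\<^bsub>F\<^esub> b))"
      unfolding A(4) using A(1) r(1) cB by (intro F.finsum_smult_ldistr) auto
    also have "\<dots> = (\<Oplus>\<^bsub>F\<^esub>b\<in>A. (r \<otimes> c b) \<odot>\<^bsub>F\<^esub> b)"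
      using cB r(1) by (intro F.M.finsum_cong') (auto simp: F.smult_assoc1)
    finally have 1: "r \<odot>\<^bsub>F\<^esub> f = (\<Oplus>\<^bsub>F\<^esub>b\<in>A. (r \<otimes> c b) \<odot>\<^bsub>F\<^esub> b)" .
    have "r \<odot>\<^bsub>M\<^esub> m = (\<Oplus>\<^bsub>M\<^esub>b\<in>A. r \<odot>\<^bsub>M\<^esub> (c b \<odot>\<^bsub>M\<^esub> \<phi> b))"
      unfolding A(5) using A(1) r(1) cB by (intro finsum_smult_ldistr) auto
    also have "\<dots> = (\<Oplus>\<^bsub>M\<^esub>b\<in>A. (r \<otimes> c b) \<odot>\<^bsub>M\<^esub> \<phi> b)"
      using cB r(1) by (intro M.finsum_cong') (auto simp: smult_assoc1)
    finally show ?thesis using 1 relI[of A "\<lambda>b. r \<otimes> c b"] A r(1) by auto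
  qed
  \<comment> \<open>Linearity of \<open>rel\<close> reduces single-valuedness to the value at zero,
    which is where independence is used.\<close>
  have rel_inj: "m = \<zero>\<^bsub>M\<^esub>" if r: "rel \<zero>\<^bsub>F\<^esub> m" for m
  proof -
    obtain A c where A: "finite A" "A \<subseteq> B" "c \<in> A \<rightarrow> carrier R" "\<zero>\<^bsub>F\<^esub> = (\<Oplus>\<^bsub>F\<^esub>b\<in>A. c b \<odot>\<^bsub>F\<^esub> b)"
      "m = (\<Oplus>\<^bsub>M\<^esub>b\<in>A. c b \<odot>\<^bsub>M\<^esub> \<phi> b)" by (rule relE[OF r])
    have "\<forall>b\<in>A. c b = \<zero>"
      using A(1-3) A(4)[symmetric]
      by (intro indep[unfolded linearly_independent_def, THEN spec, THEN spec, THEN mp] conjI)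
    moreover have "\<phi> b \<in> carrier M" if "b \<in> A" for b using that A(2) \<phi> by blast
    ultimately have "m = (\<Oplus>\<^bsub>M\<^esub>b\<in>A. \<zero>\<^bsub>M\<^esub>)"
      unfolding A(5) by (intro M.finsum_cong') auto
    then show ?thesis by simp
  qed
  have unique: "m = m'" if "rel f m" "rel f m'" for f m m'
  proof -
    have c: "f \<in> carrier F" "m \<in> carrier M" "m' \<in> carrier M" using that rel_closed by auto
    have "rel (f \<oplus>\<^bsub>F\<^esub> (\<ominus> \<one>) \<odot>\<^bsub>F\<^esub> f) (m \<oplus>\<^bsub>M\<^esub> (\<ominus> \<one>) \<odot>\<^bsub>M\<^esub> m')"
      using that by (intro rel_add rel_smult) auto
    then have "rel \<zero>\<^bsub>F\<^esub> (m \<ominus>\<^bsub>M\<^esub> m')"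
      using c by (simp add: smult_l_minus F.smult_l_minus F.M.r_neg a_minus_def)
    then have "m \<ominus>\<^bsub>M\<^esub> m' = \<zero>\<^bsub>M\<^esub>" by (rule rel_inj)
    then show ?thesis using M.diff_add_cancel[OF c(2,3)] c by simp
  qed
  have "submodule {f \<in> carrier F. \<exists>m. rel f m} R F"
    using rel_zero rel_add rel_smult by (intro F.submoduleI') blast+
  moreover have rel_basis: "rel b (\<phi> b)" if "b \<in> B" for b
  proof -
    have "b \<in> carrier F" "\<phi> b \<in> carrier M" using that B \<phi> by auto
    then show ?thesis using relI[of "{b}" "\<lambda>_. \<one>"] that by simp
  qed
  ultimately have "carrier F \<subseteq> {f \<in> carrier F. \<exists>m. rel f m}"
    using F.module_span_minimal[of "{f \<in> carrier F. \<exists>m. rel f m}" B] B by blast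
  then have ex: "\<exists>m. rel f m" if "f \<in> carrier F" for f using that by blast
  define h where "h = (\<lambda>f\<in>carrier F. THE m. rel f m)"
  have h: "h f = m" if "rel f m" for f m
    using that unique rel_closed(1)[OF that] unfolding h_def by (auto intro: the_equality)
  have rel_h: "rel f (h f)" if "f \<in> carrier F" for f using ex[OF that] h by auto
  have "h \<in> mod_hom R F M"
    unfolding mod_hom_def
  proof (intro CollectI conjI ballI)
    show "h \<in> carrier F \<rightarrow>\<^sub>E carrier M"
      using rel_h rel_closed(2) by (auto simp: h_def)
  qed (use rel_h rel_add rel_smult in \<open>auto intro!: h\<close>)
  then show ?thesis using h rel_basis by blast
qed


section \<open>Vanishing of Ext for quotients\<close>

lemma coboundaries_closed:
  assumes d: "\<And>n. d n \<in> mod_hom R (F (Suc n)) (F n)" and b: "b \<in> coboundaries R F d M i"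
    and x: "x \<in> carrier (F i)"
  shows "b x \<in> carrier M"
proof (cases i)
  case 0
  then show ?thesis using b x by (auto simp: Hom_group_def)
next
  case (Suc j)
  then obtain g where g: "g \<in> mod_hom R (F j) M" "b = compose (carrier (F (Suc j))) g (d j)"
    using b by auto
  moreover have "d j x \<in> carrier (F j)" using d[of j] x Suc by (auto simp: mod_hom_def)
  ultimately show ?thesis using x Suc mod_hom_closed by (auto simp: compose_def)
qed

text \<open>Over a complex of free modules \<open>F\<close>, homomorphisms into \<open>M / N\<close> lift to \<open>M\<close>, so this says
  that the \<open>i\<close>-th cohomology of \<open>Hom(F, M / N)\<close> vanishes.\<close>

definition cohomology_vanishes_mod ::
    "(nat \<Rightarrow> ('a, 'f) module) \<Rightarrow> (nat \<Rightarrow> 'f \<Rightarrow> 'f) \<Rightarrow> 'c set \<Rightarrow> nat \<Rightarrow> bool" where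
  "cohomology_vanishes_mod F d N i \<longleftrightarrow> (\<forall>f\<in>mod_hom R (F i) M.
     (\<forall>x\<in>carrier (F (Suc i)). f (d i x) \<in> N) \<longrightarrow>
     (\<exists>b\<in>coboundaries R F d M i. \<forall>x\<in>carrier (F i). f x \<ominus>\<^bsub>M\<^esub> b x \<in> N))"

text \<open>The long exact sequence of \<open>0 \<rightarrow> M / N \<rightarrow> M / N \<rightarrow> M / (N + y M) \<rightarrow> 0\<close>, on cocycles.\<close>

lemma cohomology_vanishes_mod_regular:
  assumes F: "\<And>n. free_module R (F n)" and d: "\<And>n. d n \<in> mod_hom R (F (Suc n)) (F n)"
    and dd: "\<And>n x. x \<in> carrier (F (Suc (Suc n))) \<Longrightarrow> d n (d (Suc n) x) = \<zero>\<^bsub>F n\<^esub>"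
    and N: "submodule N R M" and y: "y \<in> carrier R"
    and regular: "\<And>z. z \<in> carrier M \<Longrightarrow> y \<odot>\<^bsub>M\<^esub> z \<in> N \<Longrightarrow> z \<in> N"
    and van: "cohomology_vanishes_mod F d N i" "cohomology_vanishes_mod F d N (Suc i)"
  shows "cohomology_vanishes_mod F d {u \<oplus>\<^bsub>M\<^esub> y \<odot>\<^bsub>M\<^esub> v | u v. u \<in> N \<and> v \<in> carrier M} i"
  unfolding cohomology_vanishes_mod_def
proof (intro ballI impI)
  let ?N' = "{u \<oplus>\<^bsub>M\<^esub> y \<odot>\<^bsub>M\<^esub> v | u v. u \<in> N \<and> v \<in> carrier M}"
  note NE = submoduleE[OF N]
  fix f assume f: "f \<in> mod_hom R (F i) M" and fN': "\<forall>x\<in>carrier (F (Suc i)). f (d i x) \<in> ?N'"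
  have mF: "module R (F n)" for n using F by (auto simp: free_module_def)
  have d_closed: "d n x \<in> carrier (F n)" if "x \<in> carrier (F (Suc n))" for n x
    using d[of n] that by (auto simp: mod_hom_def)
  have d_add: "d n (x \<oplus>\<^bsub>F (Suc n)\<^esub> x') = d n x \<oplus>\<^bsub>F n\<^esub> d n x'"
    if "x \<in> carrier (F (Suc n))" "x' \<in> carrier (F (Suc n))" for n x x'
    using d[of n] that by (auto simp: mod_hom_def)
  have d_smult: "d n (r \<odot>\<^bsub>F (Suc n)\<^esub> x) = r \<odot>\<^bsub>F n\<^esub> d n x"
    if "x \<in> carrier (F (Suc n))" "r \<in> carrier R" for n x r
    using d[of n] that by (auto simp: mod_hom_def)
  have d_zero: "d n \<zero>\<^bsub>F (Suc n)\<^esub> = \<zero>\<^bsub>F n\<^esub>" for n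
    by (rule module.mod_hom_zero[OF mF mF d])
  obtain B where B: "B \<subseteq> carrier (F (Suc i))" "module_span R (F (Suc i)) B = carrier (F (Suc i))"
    "linearly_independent R (F (Suc i)) B" using F[of "Suc i"] by (auto simp: free_module_def)
  \<comment> \<open>Dividing by \<open>y\<close> modulo \<open>N\<close> on a basis and extending
    linearly gives a homomorphism \<open>g\<close> with \<open>f d\<close> congruent to
    \<open>y g\<close>. It represents the image of \<open>f\<close> under the connecting
    homomorphism.\<close>
  have "\<exists>v\<in>carrier M. f (d i b) \<ominus>\<^bsub>M\<^esub> y \<odot>\<^bsub>M\<^esub> v \<in> N" if b: "b \<in> B" for b
  proof -
    obtain u v where uv: "f (d i b) = u \<oplus>\<^bsub>M\<^esub> y \<odot>\<^bsub>M\<^esub> v" "u \<in> N" "v \<in> carrier M"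
      using fN' b B(1) by blast
    then have "f (d i b) \<ominus>\<^bsub>M\<^esub> y \<odot>\<^bsub>M\<^esub> v = u"
      using y NE(1) by (simp add: a_minus_def M.a_assoc M.r_neg subset_iff)
    then show ?thesis using uv(2,3) by (intro bexI[of _ v]) auto
  qed
  then obtain \<phi> where \<phi>: "\<And>b. b \<in> B \<Longrightarrow> \<phi> b \<in> carrier M"
    "\<And>b. b \<in> B \<Longrightarrow> f (d i b) \<ominus>\<^bsub>M\<^esub> y \<odot>\<^bsub>M\<^esub> \<phi> b \<in> N" by metis
  obtain g where g: "g \<in> mod_hom R (F (Suc i)) M" "\<And>b. b \<in> B \<Longrightarrow> g b = \<phi> b"
    using free_basis_hom_exists[OF mF B, of \<phi>] \<phi>(1) by blast
  note cl = mod_hom_closed[OF f] mod_hom_closed[OF g(1)] d_closed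
  \<comment> \<open>The congruence holds on the basis, and its solutions form a submodule.\<close>
  let ?H = "{x \<in> carrier (F (Suc i)). f (d i x) \<ominus>\<^bsub>M\<^esub> y \<odot>\<^bsub>M\<^esub> g x \<in> N}"
  interpret Fi: module R "F (Suc i)" by (rule mF)
  have "submodule ?H R (F (Suc i))"
  proof (rule Fi.submoduleI')
    show "\<zero>\<^bsub>F (Suc i)\<^esub> \<in> ?H"
      using d_zero mod_hom_zero[OF mF f] mod_hom_zero[OF mF g(1)] y NE(3)[OF submodule_zero[OF N]]
      by (simp add: a_minus_def)
  next
    fix a b assume a: "a \<in> ?H" "b \<in> ?H"
    then have "f (d i (a \<oplus>\<^bsub>F (Suc i)\<^esub> b)) \<ominus>\<^bsub>M\<^esub> y \<odot>\<^bsub>M\<^esub> g (a \<oplus>\<^bsub>F (Suc i)\<^esub> b)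
        = (f (d i a) \<ominus>\<^bsub>M\<^esub> y \<odot>\<^bsub>M\<^esub> g a) \<oplus>\<^bsub>M\<^esub> (f (d i b) \<ominus>\<^bsub>M\<^esub> y \<odot>\<^bsub>M\<^esub> g b)"
      using y cl by (simp add: d_add mod_hom_add[OF f] mod_hom_add[OF g(1)] smult_r_distr
          a_minus_def M.minus_add M.a_ac)
    then show "a \<oplus>\<^bsub>F (Suc i)\<^esub> b \<in> ?H" using a NE(5) by simp
  next
    fix r a assume r: "r \<in> carrier R" and a: "a \<in> ?H"
    then have "f (d i (r \<odot>\<^bsub>F (Suc i)\<^esub> a)) \<ominus>\<^bsub>M\<^esub> y \<odot>\<^bsub>M\<^esub> g (r \<odot>\<^bsub>F (Suc i)\<^esub> a)
        = r \<odot>\<^bsub>M\<^esub> (f (d i a) \<ominus>\<^bsub>M\<^esub> y \<odot>\<^bsub>M\<^esub> g a)"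
      using y cl smult_left_commute[of y r "g a"]
      by (simp add: d_smult mod_hom_smult[OF f] mod_hom_smult[OF g(1)] smult_r_distr smult_r_minus a_minus_def)
    then show "r \<odot>\<^bsub>F (Suc i)\<^esub> a \<in> ?H" using a r NE(4) by simp
  qed auto
  moreover have "B \<subseteq> ?H" using B(1) \<phi>(2) g(2) by auto
  ultimately have "carrier (F (Suc i)) \<subseteq> ?H" using Fi.module_span_minimal[of ?H B] B(2) by simp
  then have fg: "f (d i x) \<ominus>\<^bsub>M\<^esub> y \<odot>\<^bsub>M\<^esub> g x \<in> N" if "x \<in> carrier (F (Suc i))" for x
    using that by blast
  \<comment> \<open>Because \<open>d d = 0\<close>, the values of \<open>y g d\<close> lie in
    \<open>N\<close>; cancelling \<open>y\<close> makes \<open>g\<close> a cocycle modulo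
    \<open>N\<close> in degree \<open>i + 1\<close>.\<close>
  have "g (d (Suc i) x) \<in> N" if x: "x \<in> carrier (F (Suc (Suc i)))" for x
  proof (rule regular)
    show c: "g (d (Suc i) x) \<in> carrier M" using x cl by simp
    have "\<zero>\<^bsub>M\<^esub> \<ominus>\<^bsub>M\<^esub> y \<odot>\<^bsub>M\<^esub> g (d (Suc i) x) \<in> N"
      using fg[OF d_closed[OF x]] dd[OF x] mod_hom_zero[OF mF f] by simp
    then have "\<ominus>\<^bsub>M\<^esub> (\<zero>\<^bsub>M\<^esub> \<ominus>\<^bsub>M\<^esub> y \<odot>\<^bsub>M\<^esub> g (d (Suc i) x)) \<in> N" by (rule NE(3))
    then show "y \<odot>\<^bsub>M\<^esub> g (d (Suc i) x) \<in> N" using c y by (simp add: a_minus_def)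
  qed
  then obtain b where b: "b \<in> coboundaries R F d M (Suc i)"
    "\<And>x. x \<in> carrier (F (Suc i)) \<Longrightarrow> g x \<ominus>\<^bsub>M\<^esub> b x \<in> N"
    using van(2) g(1) unfolding cohomology_vanishes_mod_def by blast
  then obtain h where h: "h \<in> mod_hom R (F i) M"
    "\<And>x. x \<in> carrier (F (Suc i)) \<Longrightarrow> g x \<ominus>\<^bsub>M\<^esub> h (d i x) \<in> N"
    by (auto simp: compose_def)
  note hcl = mod_hom_closed[OF h(1)]
  \<comment> \<open>Modulo \<open>N\<close>, \<open>g\<close> is the coboundary of \<open>h\<close>.
    Subtracting \<open>y h\<close> therefore turns \<open>f\<close> into a cocycle modulo
    \<open>N\<close>, and leaves it unchanged modulo \<open>N + y M\<close>.\<close>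
  let ?f = "\<lambda>x\<in>carrier (F i). f x \<ominus>\<^bsub>M\<^esub> y \<odot>\<^bsub>M\<^esub> h x"
  have "?f (d i x) \<in> N" if x: "x \<in> carrier (F (Suc i))" for x
  proof -
    have c: "f (d i x) \<in> carrier M" "h (d i x) \<in> carrier M" "g x \<in> carrier M"
      using x cl hcl by auto
    have "(f (d i x) \<ominus>\<^bsub>M\<^esub> y \<odot>\<^bsub>M\<^esub> g x) \<oplus>\<^bsub>M\<^esub> y \<odot>\<^bsub>M\<^esub> (g x \<ominus>\<^bsub>M\<^esub> h (d i x))
        = f (d i x) \<ominus>\<^bsub>M\<^esub> y \<odot>\<^bsub>M\<^esub> h (d i x)"
      using c y by (simp add: a_minus_def smult_r_distr smult_r_minus M.a_assoc M.r_neg1)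
    moreover have "(f (d i x) \<ominus>\<^bsub>M\<^esub> y \<odot>\<^bsub>M\<^esub> g x) \<oplus>\<^bsub>M\<^esub> y \<odot>\<^bsub>M\<^esub> (g x \<ominus>\<^bsub>M\<^esub> h (d i x)) \<in> N"
      using NE(4,5) fg[OF x] h(2)[OF x] y by blast
    ultimately show ?thesis using d_closed[OF x] by simp
  qed
  with mod_hom_diff_smult[OF mF f h(1) y] van(1) obtain b
    where b: "b \<in> coboundaries R F d M i" "\<And>x. x \<in> carrier (F i) \<Longrightarrow> ?f x \<ominus>\<^bsub>M\<^esub> b x \<in> N"
    unfolding cohomology_vanishes_mod_def by blast
  have "f x \<ominus>\<^bsub>M\<^esub> b x \<in> ?N'" if x: "x \<in> carrier (F i)" for x
  proof -
    have c: "f x \<in> carrier M" "h x \<in> carrier M" "b x \<in> carrier M"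
      using x cl hcl coboundaries_closed[of d F b i x] d b(1) by auto
    have "f x \<ominus>\<^bsub>M\<^esub> b x = (f x \<oplus>\<^bsub>M\<^esub> (\<ominus>\<^bsub>M\<^esub> b x)) \<oplus>\<^bsub>M\<^esub> ((\<ominus>\<^bsub>M\<^esub> (y \<odot>\<^bsub>M\<^esub> h x)) \<oplus>\<^bsub>M\<^esub> y \<odot>\<^bsub>M\<^esub> h x)"
      using c y by (simp add: a_minus_def M.l_neg)
    also have "\<dots> = ((f x \<ominus>\<^bsub>M\<^esub> y \<odot>\<^bsub>M\<^esub> h x) \<ominus>\<^bsub>M\<^esub> b x) \<oplus>\<^bsub>M\<^esub> y \<odot>\<^bsub>M\<^esub> h x"
      using c y by (simp add: a_minus_def M.a_ac)
    finally show ?thesis using b(2)[OF x] x c by auto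
  qed
  then show "\<exists>b\<in>coboundaries R F d M i. \<forall>x\<in>carrier (F i). f x \<ominus>\<^bsub>M\<^esub> b x \<in> ?N'" using b(1) by blast
qed

text \<open>Degree 0 cohomology is \<open>Hom(R / I, M / N)\<close>, and an element \<open>z\<close>
  killed by \<open>I\<close> modulo \<open>N\<close> defines the homomorphism sending 1 to its
  class.\<close>

lemma cohomology_vanishes_mod_socle:
  assumes I: "ideal I R" and F: "\<And>n. free_module R (F n)"
    and d: "d 0 \<in> mod_hom R (F (Suc 0)) (F 0)"
    and \<epsilon>: "\<epsilon> \<in> mod_hom R (F 0) (quotient_module R I)" "\<epsilon> ` carrier (F 0) = carrier (quotient_module R I)"
    and \<epsilon>d: "\<And>x. x \<in> carrier (F (Suc 0)) \<Longrightarrow> \<epsilon> (d 0 x) = \<zero>\<^bsub>quotient_module R I\<^esub>"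
    and N: "submodule N R M" and van: "cohomology_vanishes_mod F d N 0"
    and z: "z \<in> carrier M" and Iz: "\<And>r. r \<in> I \<Longrightarrow> r \<odot>\<^bsub>M\<^esub> z \<in> N"
  shows "z \<in> N"
proof -
  interpret I: ideal I R by fact
  note NE = submoduleE[OF N]
  let ?Q = "quotient_module R I"
  interpret Q: module R ?Q by (rule module_quotient_module[OF R.is_cring I])
  interpret F0: module R "F 0" using F[of 0] by (auto simp: free_module_def)
  have hom: "(+>) I \<in> ring_hom R (R Quot I)" by (rule I.rcos_ring_hom)
  have Qs: "carrier ?Q = carrier (R Quot I)" "\<zero>\<^bsub>?Q\<^esub> = I" "a \<oplus>\<^bsub>?Q\<^esub> b = a \<oplus>\<^bsub>R Quot I\<^esub> b"
    "r \<odot>\<^bsub>?Q\<^esub> a = (I +> r) \<otimes>\<^bsub>R Quot I\<^esub> a" for a b r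
    by (simp_all add: quotient_module_def ring.defs module.defs FactRing_def)
  have Q_carrier: "\<exists>r\<in>carrier R. C = I +> r" if "C \<in> carrier ?Q" for C
    using that by (auto simp: Qs FactRing_simps)
  have Q_mem: "I +> r \<in> carrier ?Q" if "r \<in> carrier R" for r
    using ring_hom_closed[OF hom that] by (simp add: Qs)
  have Q_add: "(I +> r) \<oplus>\<^bsub>?Q\<^esub> (I +> s) = I +> (r \<oplus> s)" if "r \<in> carrier R" "s \<in> carrier R" for r s
    using ring_hom_add[OF hom that] by (simp add: Qs)
  have Q_smult: "r \<odot>\<^bsub>?Q\<^esub> (I +> s) = I +> (r \<otimes> s)" if "r \<in> carrier R" "s \<in> carrier R" for r s
    using ring_hom_mult[OF hom that] by (simp add: Qs)
  have Q_zero: "\<zero>\<^bsub>?Q\<^esub> = I +> \<zero>" using I.a_rcos_const[of \<zero>] by (simp add: Qs)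
  \<comment> \<open>This makes \<open>r z\<close> modulo \<open>N\<close> depend only on the coset
    of \<open>r\<close>.\<close>
  have coset_diff: "(r \<ominus> s) \<odot>\<^bsub>M\<^esub> z \<in> N" if "r \<in> carrier R" "s \<in> carrier R" "I +> r = I +> s" for r s
    using R.quotient_eq_iff_same_a_r_cos[OF I that(1,2)] that(3) Iz by blast
  obtain B where B: "B \<subseteq> carrier (F 0)" "module_span R (F 0) B = carrier (F 0)"
    "linearly_independent R (F 0) B" using F[of 0] by (auto simp: free_module_def)
  have \<epsilon>cl: "\<epsilon> x \<in> carrier ?Q" if "x \<in> carrier (F 0)" for x
    using Q.mod_hom_closed[OF \<epsilon>(1) that] .
  have "\<forall>b\<in>B. \<exists>r\<in>carrier R. \<epsilon> b = I +> r" using Q_carrier \<epsilon>cl B(1) by blast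
  then obtain e where e: "\<And>b. b \<in> B \<Longrightarrow> e b \<in> carrier R" "\<And>b. b \<in> B \<Longrightarrow> \<epsilon> b = I +> e b" by metis
  \<comment> \<open>\<open>f\<close> lifts to \<open>M\<close> the composite of
    \<open>\<epsilon>\<close> with the map sending 1 to the class of \<open>z\<close>; coset
    representatives are chosen on the basis only.\<close>
  obtain f where f: "f \<in> mod_hom R (F 0) M" "\<And>b. b \<in> B \<Longrightarrow> f b = e b \<odot>\<^bsub>M\<^esub> z"
    using free_basis_hom_exists[OF F0.module_axioms B, of "\<lambda>b. e b \<odot>\<^bsub>M\<^esub> z"] e(1) z by blast
  note fcl = mod_hom_closed[OF f(1)]
  let ?H = "{x \<in> carrier (F 0). \<exists>r\<in>carrier R. \<epsilon> x = I +> r \<and> f x \<ominus>\<^bsub>M\<^esub> r \<odot>\<^bsub>M\<^esub> z \<in> N}"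
  have "submodule ?H R (F 0)"
  proof (rule F0.submoduleI')
    have "f \<zero>\<^bsub>F 0\<^esub> \<ominus>\<^bsub>M\<^esub> \<zero> \<odot>\<^bsub>M\<^esub> z \<in> N"
      using mod_hom_zero[OF F0.module_axioms f(1)] NE(3)[OF submodule_zero[OF N]] z by (simp add: a_minus_def)
    then show "\<zero>\<^bsub>F 0\<^esub> \<in> ?H"
      using Q.mod_hom_zero[OF F0.module_axioms \<epsilon>(1)] Q_zero by auto
  next
    fix a b assume "a \<in> ?H" "b \<in> ?H"
    then obtain r s where a: "a \<in> carrier (F 0)" "r \<in> carrier R" "\<epsilon> a = I +> r" "f a \<ominus>\<^bsub>M\<^esub> r \<odot>\<^bsub>M\<^esub> z \<in> N"
      and b: "b \<in> carrier (F 0)" "s \<in> carrier R" "\<epsilon> b = I +> s" "f b \<ominus>\<^bsub>M\<^esub> s \<odot>\<^bsub>M\<^esub> z \<in> N" by auto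
    have "f (a \<oplus>\<^bsub>F 0\<^esub> b) \<ominus>\<^bsub>M\<^esub> (r \<oplus> s) \<odot>\<^bsub>M\<^esub> z = (f a \<ominus>\<^bsub>M\<^esub> r \<odot>\<^bsub>M\<^esub> z) \<oplus>\<^bsub>M\<^esub> (f b \<ominus>\<^bsub>M\<^esub> s \<odot>\<^bsub>M\<^esub> z)"
      using a(1,2) b(1,2) z fcl
      by (simp add: mod_hom_add[OF f(1)] smult_l_distr a_minus_def M.minus_add M.a_ac)
    then have "f (a \<oplus>\<^bsub>F 0\<^esub> b) \<ominus>\<^bsub>M\<^esub> (r \<oplus> s) \<odot>\<^bsub>M\<^esub> z \<in> N" using NE(5)[OF a(4) b(4)] by simp
    moreover have "\<epsilon> (a \<oplus>\<^bsub>F 0\<^esub> b) = I +> (r \<oplus> s)"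
      using Q.mod_hom_add[OF \<epsilon>(1) a(1) b(1)] Q_add a b by simp
    ultimately show "a \<oplus>\<^bsub>F 0\<^esub> b \<in> ?H" using a(1,2) b(1,2) by blast
  next
    fix t a assume t: "t \<in> carrier R" and "a \<in> ?H"
    then obtain r where a: "a \<in> carrier (F 0)" "r \<in> carrier R" "\<epsilon> a = I +> r" "f a \<ominus>\<^bsub>M\<^esub> r \<odot>\<^bsub>M\<^esub> z \<in> N" by auto
    have "f (t \<odot>\<^bsub>F 0\<^esub> a) \<ominus>\<^bsub>M\<^esub> (t \<otimes> r) \<odot>\<^bsub>M\<^esub> z = t \<odot>\<^bsub>M\<^esub> (f a \<ominus>\<^bsub>M\<^esub> r \<odot>\<^bsub>M\<^esub> z)"
      using a(1,2) z t fcl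
      by (simp add: mod_hom_smult[OF f(1)] smult_assoc1 a_minus_def smult_r_distr smult_r_minus)
    then have "f (t \<odot>\<^bsub>F 0\<^esub> a) \<ominus>\<^bsub>M\<^esub> (t \<otimes> r) \<odot>\<^bsub>M\<^esub> z \<in> N" using NE(4)[OF t a(4)] by simp
    moreover have "\<epsilon> (t \<odot>\<^bsub>F 0\<^esub> a) = I +> (t \<otimes> r)"
      using Q.mod_hom_smult[OF \<epsilon>(1) t a(1)] Q_smult[OF t a(2)] a(3) by simp
    ultimately show "t \<odot>\<^bsub>F 0\<^esub> a \<in> ?H" using a(1,2) t by blast
  qed auto
  moreover have "B \<subseteq> ?H"
  proof
    fix b assume b: "b \<in> B"
    then have "f b \<ominus>\<^bsub>M\<^esub> e b \<odot>\<^bsub>M\<^esub> z = \<zero>\<^bsub>M\<^esub>" using f(2) e(1) z by (simp add: a_minus_def M.r_neg)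
    then show "b \<in> ?H" using b e B(1) submodule_zero[OF N] by auto
  qed
  ultimately have "carrier (F 0) \<subseteq> ?H" using F0.module_span_minimal[of ?H B] B(2) by blast
  then have fH: "\<exists>r\<in>carrier R. \<epsilon> x = I +> r \<and> f x \<ominus>\<^bsub>M\<^esub> r \<odot>\<^bsub>M\<^esub> z \<in> N" if "x \<in> carrier (F 0)" for x
    using that by blast
  have fz: "f x \<in> N \<longleftrightarrow> r \<odot>\<^bsub>M\<^esub> z \<in> N"
    if x: "x \<in> carrier (F 0)" and r: "r \<in> carrier R" and xr: "\<epsilon> x = I +> r" for x r
  proof -
    obtain s where s: "s \<in> carrier R" "\<epsilon> x = I +> s" "f x \<ominus>\<^bsub>M\<^esub> s \<odot>\<^bsub>M\<^esub> z \<in> N" using fH[OF x] by blast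
    have sr: "(s \<ominus> r) \<odot>\<^bsub>M\<^esub> z \<in> N" using coset_diff[OF s(1) r] s(2) xr by simp
    have "f x = (f x \<ominus>\<^bsub>M\<^esub> s \<odot>\<^bsub>M\<^esub> z) \<oplus>\<^bsub>M\<^esub> s \<odot>\<^bsub>M\<^esub> z"
      using fcl[OF x] s(1) z by (simp add: M.diff_add_cancel)
    then have 1: "f x \<in> N \<longleftrightarrow> s \<odot>\<^bsub>M\<^esub> z \<in> N"
      using submodule_add_left_iff[OF N s(3), of "s \<odot>\<^bsub>M\<^esub> z"] s(1) z by simp
    have "s \<odot>\<^bsub>M\<^esub> z = (s \<ominus> r) \<odot>\<^bsub>M\<^esub> z \<oplus>\<^bsub>M\<^esub> r \<odot>\<^bsub>M\<^esub> z"
      using s(1) r z by (simp add: smult_l_distr[symmetric] R.diff_add_cancel)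
    then show ?thesis using 1 submodule_add_left_iff[OF N sr, of "r \<odot>\<^bsub>M\<^esub> z"] r z by simp
  qed
  have "f (d 0 x) \<in> N" if x: "x \<in> carrier (F (Suc 0))" for x
  proof -
    have "d 0 x \<in> carrier (F 0)" using F0.mod_hom_closed[OF d x] .
    then show ?thesis using fz[of "d 0 x" \<zero>] \<epsilon>d[OF x] Q_zero z submodule_zero[OF N] by simp
  qed
  then obtain b where "b \<in> coboundaries R F d M 0" "\<forall>x\<in>carrier (F 0). f x \<ominus>\<^bsub>M\<^esub> b x \<in> N"
    using van f(1) unfolding cohomology_vanishes_mod_def by blast
  \<comment> \<open>The only coboundary in degree 0 is zero, so \<open>f\<close> itself takes values
    in \<open>N\<close>.\<close>
  then have fN: "f x \<in> N" if "x \<in> carrier (F 0)" for x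
    using that fcl[OF that] M.diff_add_cancel[of "f x" "\<zero>\<^bsub>M\<^esub>"] by (auto simp: Hom_group_def)
  \<comment> \<open>Surjectivity of \<open>\<epsilon>\<close> supplies an \<open>x\<close> above 1,
    where \<open>f x\<close> is congruent to \<open>z\<close>.\<close>
  have "I +> \<one> \<in> \<epsilon> ` carrier (F 0)" using \<epsilon>(2) Q_mem[of \<one>] by simp
  then obtain x where "x \<in> carrier (F 0)" "\<epsilon> x = I +> \<one>" by auto
  then show ?thesis using fz[of x \<one>] fN z by simp
qed

end


section \<open>Linear combinations of generators\<close>

context module
begin

lemma finsum_in_submodule:
  assumes "submodule H R M" "finite A" "\<And>a. a \<in> A \<Longrightarrow> g a \<in> H"
  shows "(\<Oplus>\<^bsub>M\<^esub>a\<in>A. g a) \<in> H"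
  using assms(2,3)
proof (induction A)
  case (insert a A)
  have "g ` insert a A \<subseteq> carrier M" using insert.prems submoduleE(1)[OF assms(1)] by blast
  then have "(\<Oplus>\<^bsub>M\<^esub>a\<in>insert a A. g a) = g a \<oplus>\<^bsub>M\<^esub> (\<Oplus>\<^bsub>M\<^esub>a\<in>A. g a)"
    using insert.hyps by (intro M.finsum_insert) auto
  then show ?case using insert submoduleE(5)[OF assms(1)] by simp
qed (simp add: submodule_zero[OF assms(1)])

text \<open>For a finite generating set \<open>B\<close> of \<open>M\<close> and an ideal
  \<open>I\<close> this is \<open>I M\<close>. All sums run over the same \<open>B\<close>, so that
  relations can be handled coefficient by coefficient.\<close>

definition ideal_combinations :: "'c set \<Rightarrow> 'a set \<Rightarrow> 'c set" where
  "ideal_combinations B I = {\<Oplus>\<^bsub>M\<^esub>b\<in>B. c b \<odot>\<^bsub>M\<^esub> b | c. c \<in> B \<rightarrow> I}"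

lemma ideal_combinationsI:
  "c \<in> B \<rightarrow> I \<Longrightarrow> (\<Oplus>\<^bsub>M\<^esub>b\<in>B. c b \<odot>\<^bsub>M\<^esub> b) \<in> ideal_combinations B I"
  unfolding ideal_combinations_def by blast

lemma ideal_combinationsE:
  assumes "z \<in> ideal_combinations B I"
  obtains c where "c \<in> B \<rightarrow> I" "z = (\<Oplus>\<^bsub>M\<^esub>b\<in>B. c b \<odot>\<^bsub>M\<^esub> b)"
  using assms unfolding ideal_combinations_def by blast

lemma combination_closed:
  assumes "B \<subseteq> carrier M" "c \<in> B \<rightarrow> carrier R"
  shows "(\<Oplus>\<^bsub>M\<^esub>b\<in>B. c b \<odot>\<^bsub>M\<^esub> b) \<in> carrier M"
  using assms by (intro M.finsum_closed) auto

lemma combination_add: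
  assumes "finite B" "B \<subseteq> carrier M" "c \<in> B \<rightarrow> carrier R" "c' \<in> B \<rightarrow> carrier R"
  shows "(\<Oplus>\<^bsub>M\<^esub>b\<in>B. (c b \<oplus> c' b) \<odot>\<^bsub>M\<^esub> b)
    = (\<Oplus>\<^bsub>M\<^esub>b\<in>B. c b \<odot>\<^bsub>M\<^esub> b) \<oplus>\<^bsub>M\<^esub> (\<Oplus>\<^bsub>M\<^esub>b\<in>B. c' b \<odot>\<^bsub>M\<^esub> b)"
proof -
  have cl: "c b \<in> carrier R" "c' b \<in> carrier R" "b \<in> carrier M" if "b \<in> B" for b
    using assms that by auto
  have "(\<Oplus>\<^bsub>M\<^esub>b\<in>B. (c b \<oplus> c' b) \<odot>\<^bsub>M\<^esub> b) = (\<Oplus>\<^bsub>M\<^esub>b\<in>B. c b \<odot>\<^bsub>M\<^esub> b \<oplus>\<^bsub>M\<^esub> c' b \<odot>\<^bsub>M\<^esub> b)"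
    using cl by (intro M.finsum_cong') (auto simp: smult_l_distr)
  also have "\<dots> = (\<Oplus>\<^bsub>M\<^esub>b\<in>B. c b \<odot>\<^bsub>M\<^esub> b) \<oplus>\<^bsub>M\<^esub> (\<Oplus>\<^bsub>M\<^esub>b\<in>B. c' b \<odot>\<^bsub>M\<^esub> b)"
    using cl by (intro M.finsum_addf) auto
  finally show ?thesis .
qed

lemma combination_smult:
  assumes "finite B" "B \<subseteq> carrier M" "c \<in> B \<rightarrow> carrier R" "r \<in> carrier R"
  shows "(\<Oplus>\<^bsub>M\<^esub>b\<in>B. (r \<otimes> c b) \<odot>\<^bsub>M\<^esub> b) = r \<odot>\<^bsub>M\<^esub> (\<Oplus>\<^bsub>M\<^esub>b\<in>B. c b \<odot>\<^bsub>M\<^esub> b)"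
proof -
  have cl: "c b \<in> carrier R" "b \<in> carrier M" if "b \<in> B" for b
    using assms that by auto
  have "(\<Oplus>\<^bsub>M\<^esub>b\<in>B. (r \<otimes> c b) \<odot>\<^bsub>M\<^esub> b) = (\<Oplus>\<^bsub>M\<^esub>b\<in>B. r \<odot>\<^bsub>M\<^esub> (c b \<odot>\<^bsub>M\<^esub> b))"
    using cl assms(4) by (intro M.finsum_cong') (auto simp: smult_assoc1)
  also have "\<dots> = r \<odot>\<^bsub>M\<^esub> (\<Oplus>\<^bsub>M\<^esub>b\<in>B. c b \<odot>\<^bsub>M\<^esub> b)"
    using cl assms(1,4) by (intro finsum_smult_ldistr[symmetric]) auto
  finally show ?thesis .
qed

lemma ideal_combinations_submodule:
  assumes B: "finite B" "B \<subseteq> carrier M" and I: "ideal I R"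
  shows "submodule (ideal_combinations B I) R M"
proof (rule submoduleI')
  interpret I: ideal I R by fact
  have cR: "c \<in> B \<rightarrow> carrier R" if "c \<in> B \<rightarrow> I" for c using that I.Icarr by blast
  show "ideal_combinations B I \<subseteq> carrier M"
    using combination_closed[OF B(2) cR] by (auto elim!: ideal_combinationsE)
  have "(\<Oplus>\<^bsub>M\<^esub>b\<in>B. \<zero> \<odot>\<^bsub>M\<^esub> b) = (\<Oplus>\<^bsub>M\<^esub>b\<in>B. \<zero>\<^bsub>M\<^esub>)" using B by (intro M.finsum_cong') auto
  then show "\<zero>\<^bsub>M\<^esub> \<in> ideal_combinations B I"
    using ideal_combinationsI[of "\<lambda>_. \<zero>" B I] by simp
  show "x \<oplus>\<^bsub>M\<^esub> y \<in> ideal_combinations B I"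
    if xy: "x \<in> ideal_combinations B I" "y \<in> ideal_combinations B I" for x y
  proof -
    obtain c c' where c: "c \<in> B \<rightarrow> I" "x = (\<Oplus>\<^bsub>M\<^esub>b\<in>B. c b \<odot>\<^bsub>M\<^esub> b)"
      "c' \<in> B \<rightarrow> I" "y = (\<Oplus>\<^bsub>M\<^esub>b\<in>B. c' b \<odot>\<^bsub>M\<^esub> b)" using xy by (elim ideal_combinationsE)
    then show ?thesis
      using combination_add[OF B cR[OF c(1)] cR[OF c(3)]] ideal_combinationsI[of "\<lambda>b. c b \<oplus> c' b" B I]
      by (simp add: Pi_iff)
  qed
  show "r \<odot>\<^bsub>M\<^esub> x \<in> ideal_combinations B I"
    if r: "r \<in> carrier R" and x: "x \<in> ideal_combinations B I" for r x
  proof -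
    obtain c where c: "c \<in> B \<rightarrow> I" "x = (\<Oplus>\<^bsub>M\<^esub>b\<in>B. c b \<odot>\<^bsub>M\<^esub> b)"
      using x by (elim ideal_combinationsE)
    then show ?thesis
      using combination_smult[OF B cR[OF c(1)] r] ideal_combinationsI[of "\<lambda>b. r \<otimes> c b" B I] r I.I_l_closed
      by (simp add: Pi_iff)
  qed
qed

lemma module_span_finite:
  assumes B: "finite B" "B \<subseteq> carrier M"
  shows "module_span R M B = ideal_combinations B (carrier R)"
proof
  have "b \<in> ideal_combinations B (carrier R)" if b: "b \<in> B" for b
  proof -
    have "(\<Oplus>\<^bsub>M\<^esub>b'\<in>B. (if b' \<in> {b} then \<one> else \<zero>) \<odot>\<^bsub>M\<^esub> b') = (\<Oplus>\<^bsub>M\<^esub>b'\<in>{b}. \<one> \<odot>\<^bsub>M\<^esub> b')"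
      using B b by (intro finsum_smult_extend[symmetric]) auto
    also have "\<dots> = b" using B b by auto
    finally show ?thesis
      using ideal_combinationsI[of "\<lambda>b'. if b' \<in> {b} then \<one> else \<zero>" B "carrier R"] by simp
  qed
  then show "module_span R M B \<subseteq> ideal_combinations B (carrier R)"
    by (intro module_span_minimal ideal_combinations_submodule B R.oneideal) auto
  show "ideal_combinations B (carrier R) \<subseteq> module_span R M B"
  proof
    fix z assume "z \<in> ideal_combinations B (carrier R)"
    then obtain c where c: "c \<in> B \<rightarrow> carrier R" "z = (\<Oplus>\<^bsub>M\<^esub>b\<in>B. c b \<odot>\<^bsub>M\<^esub> b)"
      by (elim ideal_combinationsE)
    note S = module_span_submodule[OF B(2)]
    show "z \<in> module_span R M B"
      unfolding c(2) using c(1) module_span_superset[of B] submoduleE(4)[OF S]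
      by (intro finsum_in_submodule S B) blast
  qed
qed

lemma ideal_combinations_smult:
  assumes B: "finite B" "B \<subseteq> carrier M" "module_span R M B = carrier M" and I: "ideal I R"
    and r: "r \<in> I" and z: "z \<in> carrier M"
  shows "r \<odot>\<^bsub>M\<^esub> z \<in> ideal_combinations B I"
proof -
  interpret I: ideal I R by fact
  obtain c where c: "c \<in> B \<rightarrow> carrier R" "z = (\<Oplus>\<^bsub>M\<^esub>b\<in>B. c b \<odot>\<^bsub>M\<^esub> b)"
    using z B(3) module_span_finite[OF B(1,2)] by (metis ideal_combinationsE)
  then show ?thesis
    using combination_smult[OF B(1,2) c(1) I.Icarr[OF r]] ideal_combinationsI[of "\<lambda>b. r \<otimes> c b" B I]
      I.I_r_closed[OF r] by (simp add: Pi_iff)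
qed

text \<open>The splitting is recorded for the coefficients as well as for the sums, because the
  descent continues with the family \<open>t\<close> itself.\<close>

lemma combination_add_cgenideal:
  assumes B: "finite B" "B \<subseteq> carrier M" and I: "ideal I R" and y: "y \<in> carrier R"
    and c: "c \<in> B \<rightarrow> I <+>\<^bsub>R\<^esub> PIdl y"
  obtains i t where "i \<in> B \<rightarrow> I" "t \<in> B \<rightarrow> carrier R" "\<forall>b\<in>B. c b = i b \<oplus> t b \<otimes> y"
    "(\<Oplus>\<^bsub>M\<^esub>b\<in>B. c b \<odot>\<^bsub>M\<^esub> b) = (\<Oplus>\<^bsub>M\<^esub>b\<in>B. i b \<odot>\<^bsub>M\<^esub> b) \<oplus>\<^bsub>M\<^esub> y \<odot>\<^bsub>M\<^esub> (\<Oplus>\<^bsub>M\<^esub>b\<in>B. t b \<odot>\<^bsub>M\<^esub> b)"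
proof -
  interpret I: ideal I R by fact
  have "\<forall>b\<in>B. \<exists>i t. i \<in> I \<and> t \<in> carrier R \<and> c b = i \<oplus> t \<otimes> y"
    using c R.mem_add_cgenideal by blast
  then obtain i t where it: "\<And>b. b \<in> B \<Longrightarrow> i b \<in> I" "\<And>b. b \<in> B \<Longrightarrow> t b \<in> carrier R"
    "\<And>b. b \<in> B \<Longrightarrow> c b = i b \<oplus> t b \<otimes> y" by metis
  have iR: "i b \<in> carrier R" if "b \<in> B" for b using it(1)[OF that] I.Icarr by blast
  have "(\<Oplus>\<^bsub>M\<^esub>b\<in>B. c b \<odot>\<^bsub>M\<^esub> b) = (\<Oplus>\<^bsub>M\<^esub>b\<in>B. (i b \<oplus> y \<otimes> t b) \<odot>\<^bsub>M\<^esub> b)"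
  proof (rule M.finsum_cong')
    show "(\<lambda>b. (i b \<oplus> y \<otimes> t b) \<odot>\<^bsub>M\<^esub> b) \<in> B \<rightarrow> carrier M" using B(2) iR it(2) y by auto
    show "c b \<odot>\<^bsub>M\<^esub> b = (i b \<oplus> y \<otimes> t b) \<odot>\<^bsub>M\<^esub> b" if "b \<in> B" for b
      using it(3)[OF that] R.m_comm[OF it(2)[OF that] y] by simp
  qed simp
  also have "\<dots> = (\<Oplus>\<^bsub>M\<^esub>b\<in>B. i b \<odot>\<^bsub>M\<^esub> b) \<oplus>\<^bsub>M\<^esub> (\<Oplus>\<^bsub>M\<^esub>b\<in>B. (y \<otimes> t b) \<odot>\<^bsub>M\<^esub> b)"
    using iR it(2) y by (intro combination_add B) auto
  also have "(\<Oplus>\<^bsub>M\<^esub>b\<in>B. (y \<otimes> t b) \<odot>\<^bsub>M\<^esub> b) = y \<odot>\<^bsub>M\<^esub> (\<Oplus>\<^bsub>M\<^esub>b\<in>B. t b \<odot>\<^bsub>M\<^esub> b)"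
    using it(2) y by (intro combination_smult B) auto
  finally show ?thesis using that[of i t] it by blast
qed

text \<open>Brings \<open>(I + (y)) M\<close> into the shape \<open>N + y M\<close> for which
  \<open>cohomology_vanishes_mod_regular\<close> delivers vanishing.\<close>

lemma ideal_combinations_add_cgenideal:
  assumes B: "finite B" "B \<subseteq> carrier M" "module_span R M B = carrier M"
    and I: "ideal I R" and y: "y \<in> carrier R"
  shows "ideal_combinations B (I <+>\<^bsub>R\<^esub> PIdl y)
    = {u \<oplus>\<^bsub>M\<^esub> y \<odot>\<^bsub>M\<^esub> v | u v. u \<in> ideal_combinations B I \<and> v \<in> carrier M}"
proof (intro equalityI subsetI)
  fix z assume "z \<in> ideal_combinations B (I <+>\<^bsub>R\<^esub> PIdl y)"
  then obtain c where c: "c \<in> B \<rightarrow> I <+>\<^bsub>R\<^esub> PIdl y" "z = (\<Oplus>\<^bsub>M\<^esub>b\<in>B. c b \<odot>\<^bsub>M\<^esub> b)"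
    by (elim ideal_combinationsE)
  obtain i t where "i \<in> B \<rightarrow> I" "t \<in> B \<rightarrow> carrier R"
    "z = (\<Oplus>\<^bsub>M\<^esub>b\<in>B. i b \<odot>\<^bsub>M\<^esub> b) \<oplus>\<^bsub>M\<^esub> y \<odot>\<^bsub>M\<^esub> (\<Oplus>\<^bsub>M\<^esub>b\<in>B. t b \<odot>\<^bsub>M\<^esub> b)"
    by (rule combination_add_cgenideal[OF B(1,2) I y c(1), folded c(2)])
  then show "z \<in> {u \<oplus>\<^bsub>M\<^esub> y \<odot>\<^bsub>M\<^esub> v | u v. u \<in> ideal_combinations B I \<and> v \<in> carrier M}"
    using ideal_combinationsI combination_closed[OF B(2)] by blast
next
  note J = R.ideal_add_cgenideal[OF I y]
  note S = ideal_combinations_submodule[OF B(1,2) J(1)]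
  fix z assume "z \<in> {u \<oplus>\<^bsub>M\<^esub> y \<odot>\<^bsub>M\<^esub> v | u v. u \<in> ideal_combinations B I \<and> v \<in> carrier M}"
  then obtain u v where uv: "z = u \<oplus>\<^bsub>M\<^esub> y \<odot>\<^bsub>M\<^esub> v" "u \<in> ideal_combinations B I" "v \<in> carrier M" by blast
  have "u \<in> ideal_combinations B (I <+>\<^bsub>R\<^esub> PIdl y)"
    using uv(2) J(2) unfolding ideal_combinations_def by blast
  then show "z \<in> ideal_combinations B (I <+>\<^bsub>R\<^esub> PIdl y)"
    unfolding uv(1) using submoduleE(5)[OF S] ideal_combinations_smult[OF B J(1) J(3) uv(3)] by blast
qed

text \<open>Induction on the number of generators \<open>X\<close> of the maximal ideal modulo \<open>I\<close>: the element \<open>y\<close>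
  is an \<open>M / I M\<close>-regular element that can replace one of the generators, and Nakayama's lemma
  descends from \<open>I + (y)\<close> to \<open>I\<close>.\<close>

lemma relation_coefficients:
  assumes noeth: "noetherian_ring R" and \<mm>: "maximalideal \<mm> R"
    and unit: "\<And>a. a \<in> carrier R \<Longrightarrow> a \<notin> \<mm> \<Longrightarrow> a \<in> Units R"
    and res: "free_resolution R (quotient_module R \<mm>) F d \<epsilon>"
    and B: "finite B" "B \<subseteq> carrier M" "module_span R M B = carrier M"
    and minimal: "\<And>c. c \<in> B \<rightarrow> carrier R \<Longrightarrow>
      (\<Oplus>\<^bsub>M\<^esub>b\<in>B. c b \<odot>\<^bsub>M\<^esub> b) \<in> ideal_combinations B \<mm> \<Longrightarrow> c \<in> B \<rightarrow> \<mm>"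
    and X: "finite X" "X \<subseteq> carrier R" and I: "ideal I R" "Idl (I \<union> X) = \<mm>"
    and van: "\<And>i. i < card X \<Longrightarrow> cohomology_vanishes_mod F d (ideal_combinations B I) i"
    and c: "c \<in> B \<rightarrow> carrier R" "(\<Oplus>\<^bsub>M\<^esub>b\<in>B. c b \<odot>\<^bsub>M\<^esub> b) \<in> ideal_combinations B I"
  shows "c \<in> B \<rightarrow> I"
  using X I van c
proof (induction X arbitrary: I c rule: finite_induct)
  case empty
  \<comment> \<open>With no generators left, the claim is the minimality of
    \<open>B\<close>.\<close>
  then have "\<mm> = I"
    using R.genideal_minimal[of I I] R.genideal_self[of I] ideal.Icarr[of I R] by auto
  then show ?case using empty minimal by simp
next
  case (insert x X)
  interpret \<mm>: maximalideal \<mm> R by fact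
  interpret I: ideal I R by (rule insert.prems)
  have fg: "finitely_generated_module R M"
    using B module_axioms by (auto simp: finitely_generated_module_def)
  have F: "\<And>n. free_module R (F n)" and d: "\<And>n. d n \<in> mod_hom R (F (Suc n)) (F n)"
    and \<epsilon>: "\<epsilon> \<in> mod_hom R (F 0) (quotient_module R \<mm>)" "\<epsilon> ` carrier (F 0) = carrier (quotient_module R \<mm>)"
    and d0: "d 0 ` carrier (F 1) = module_ker (F 0) (quotient_module R \<mm>) \<epsilon>"
    and dS: "\<And>n. d (Suc n) ` carrier (F (Suc (Suc n))) = module_ker (F (Suc n)) (F n) (d n)"
    using res by (auto simp: free_resolution_def)
  have dd: "d n (d (Suc n) x) = \<zero>\<^bsub>F n\<^esub>" if "x \<in> carrier (F (Suc (Suc n)))" for n x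
    using dS[of n] that by (auto simp: module_ker_def)
  have \<epsilon>d: "\<epsilon> (d 0 x) = \<zero>\<^bsub>quotient_module R \<mm>\<^esub>" if "x \<in> carrier (F (Suc 0))" for x
    using d0 that by (auto simp: module_ker_def)
  let ?N = "ideal_combinations B I"
  note N = ideal_combinations_submodule[OF B(1,2) insert.prems(2)]
  have IX: "I \<union> insert x X \<subseteq> carrier R" using insert.prems(1) I.Icarr by blast
  have Xc: "X \<subseteq> carrier R" "x \<in> carrier R" using insert.prems(1) by auto
  note J = R.genideal_ideal[OF Xc(1)]
  interpret J: ideal "Idl X" R by (rule J)
  have sub\<mm>: "I \<subseteq> \<mm>" "x \<in> \<mm>" "X \<subseteq> \<mm>" using R.genideal_self[OF IX] insert.prems(3) by auto
  have J\<mm>: "Idl X \<subseteq> \<mm>" by (rule R.genideal_minimal[OF \<mm>.is_ideal sub\<mm>(3)])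
  have "\<exists>j\<in>Idl X. \<forall>z\<in>carrier M. (x \<oplus> j) \<odot>\<^bsub>M\<^esub> z \<in> ?N \<longrightarrow> z \<in> ?N"
  proof (rule regular_element_in_coset[OF noeth fg N Xc(2) J])
    fix z assume z: "z \<in> carrier M" "x \<odot>\<^bsub>M\<^esub> z \<in> ?N" "\<forall>j\<in>Idl X. j \<odot>\<^bsub>M\<^esub> z \<in> ?N"
    \<comment> \<open>\<open>I\<close> kills \<open>M / I M\<close> anyway, so a class killed by
      \<open>x\<close> and \<open>X\<close> is killed by all of \<mm>, and vanishing in degree 0
      makes it zero.\<close>
    have "I \<union> insert x X \<subseteq> annihilator_mod ?N z"
      using IX z ideal_combinations_smult[OF B insert.prems(2) _ z(1)] R.genideal_self[OF Xc(1)]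
      by (auto simp: annihilator_mod_def)
    then have "\<mm> \<subseteq> annihilator_mod ?N z"
      using R.genideal_minimal[OF annihilator_mod_ideal[OF N z(1)]] insert.prems(3) by blast
    then have "\<And>r. r \<in> \<mm> \<Longrightarrow> r \<odot>\<^bsub>M\<^esub> z \<in> ?N" unfolding annihilator_mod_def by blast
    moreover have "cohomology_vanishes_mod F d ?N 0" using insert.prems(4)[of 0] insert.hyps by simp
    ultimately show "z \<in> ?N"
      by (intro cohomology_vanishes_mod_socle[of \<mm> F d \<epsilon> ?N z] \<mm>.is_ideal F d \<epsilon> \<epsilon>d N z(1))
  qed
  then obtain j where j: "j \<in> Idl X" and
    regular: "\<And>z. z \<in> carrier M \<Longrightarrow> (x \<oplus> j) \<odot>\<^bsub>M\<^esub> z \<in> ?N \<Longrightarrow> z \<in> ?N" by blast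
  define y where "y = x \<oplus> j"
  have jc: "j \<in> carrier R" using j J.Icarr by blast
  have yc: "y \<in> carrier R" and y\<mm>: "y \<in> \<mm>" using Xc jc sub\<mm>(2) j J\<mm> by (auto simp: y_def)
  let ?I' = "I <+>\<^bsub>R\<^esub> PIdl y"
  note I' = R.ideal_add_cgenideal[OF insert.prems(2) yc]
  interpret I': ideal ?I' R by (rule I')
  have I'Xc: "?I' \<union> X \<subseteq> carrier R" using Xc I'.Icarr by blast
  note K = R.genideal_ideal[OF I'Xc] and Ks = R.genideal_self[OF I'Xc]
  interpret K: ideal "Idl (?I' \<union> X)" R by (rule K)
  \<comment> \<open>The exchange: \<open>x = y - j\<close> with \<open>j\<close> in the ideal
    generated by \<open>X\<close>, so \<open>y\<close> and \<open>X\<close> recover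
    \<open>x\<close>.\<close>
  have gen: "Idl (?I' \<union> X) = \<mm>"
  proof
    have "?I' \<subseteq> \<mm>"
    proof
      fix a assume "a \<in> ?I'"
      then obtain i t where a: "i \<in> I" "t \<in> carrier R" "a = i \<oplus> t \<otimes> y"
        unfolding R.mem_add_cgenideal by blast
      have "i \<in> \<mm>" "t \<otimes> y \<in> \<mm>" using a sub\<mm>(1) \<mm>.I_l_closed[OF y\<mm>] by blast+
      then show "a \<in> \<mm>" unfolding a(3) by (rule \<mm>.a_closed)
    qed
    then show "Idl (?I' \<union> X) \<subseteq> \<mm>" using sub\<mm>(3) by (intro R.genideal_minimal[OF \<mm>.is_ideal]) auto
    have "X \<subseteq> Idl (?I' \<union> X)" using Ks by blast
    from R.genideal_minimal[OF K this] have "j \<in> Idl (?I' \<union> X)" using j by blast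
    then have "\<ominus> j \<in> Idl (?I' \<union> X)" by blast
    moreover have "y \<in> Idl (?I' \<union> X)" using Ks I'(3) by blast
    ultimately have "y \<oplus> \<ominus> j \<in> Idl (?I' \<union> X)" by blast
    moreover have "y \<oplus> \<ominus> j = x" unfolding y_def using Xc(2) jc by (simp add: R.a_assoc R.r_neg)
    ultimately have "I \<union> insert x X \<subseteq> Idl (?I' \<union> X)" using Ks I'(2) by auto
    then show "\<mm> \<subseteq> Idl (?I' \<union> X)" using R.genideal_minimal[OF K] insert.prems(3) by blast
  qed
  \<comment> \<open>Degree \<open>i\<close> modulo \<open>I + (y)\<close> uses degrees
    \<open>i\<close> and \<open>i + 1\<close> modulo \<open>I\<close>. The degree lost is matched by
    the generator removed.\<close>
  have van': "cohomology_vanishes_mod F d (ideal_combinations B ?I') i" if "i < card X" for i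
    unfolding ideal_combinations_add_cgenideal[OF B insert.prems(2) yc]
    using that insert.hyps
    by (intro cohomology_vanishes_mod_regular F d dd N yc insert.prems(4)) (use regular y_def in auto)
  let ?K = "{c \<in> B \<rightarrow> carrier R. (\<Oplus>\<^bsub>M\<^esub>b\<in>B. c b \<odot>\<^bsub>M\<^esub> b) \<in> ?N}"
  \<comment> \<open>A relation modulo \<open>I M\<close> is also one modulo
    \<open>(I + (y)) M\<close>, so the induction hypothesis puts its coefficients into
    \<open>I + (y)\<close>.\<close>
  have descend: "\<exists>i t. i \<in> B \<rightarrow> I \<and> t \<in> ?K \<and> (\<forall>b\<in>B. c b = i b \<oplus> t b \<otimes> y)" if c: "c \<in> ?K" for c
  proof -
    have "(\<Oplus>\<^bsub>M\<^esub>b\<in>B. c b \<odot>\<^bsub>M\<^esub> b) \<in> ideal_combinations B ?I'"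
      using c I'(2) unfolding ideal_combinations_def by blast
    then have "c \<in> B \<rightarrow> ?I'" using c insert.IH[OF Xc(1) I'(1) gen van'] by blast
    then obtain i t where it: "i \<in> B \<rightarrow> I" "t \<in> B \<rightarrow> carrier R" "\<forall>b\<in>B. c b = i b \<oplus> t b \<otimes> y"
      "(\<Oplus>\<^bsub>M\<^esub>b\<in>B. c b \<odot>\<^bsub>M\<^esub> b) = (\<Oplus>\<^bsub>M\<^esub>b\<in>B. i b \<odot>\<^bsub>M\<^esub> b) \<oplus>\<^bsub>M\<^esub> y \<odot>\<^bsub>M\<^esub> (\<Oplus>\<^bsub>M\<^esub>b\<in>B. t b \<odot>\<^bsub>M\<^esub> b)"
      by (rule combination_add_cgenideal[OF B(1,2) insert.prems(2) yc])
    \<comment> \<open>The \<open>i\<close>-part lies in \<open>I M\<close>, hence so does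
      \<open>y\<close> times the \<open>t\<close>-combination; cancelling the regular
      \<open>y\<close> makes \<open>t\<close> a relation again.\<close>
    note tM = combination_closed[OF B(2) it(2)]
    have "y \<odot>\<^bsub>M\<^esub> (\<Oplus>\<^bsub>M\<^esub>b\<in>B. t b \<odot>\<^bsub>M\<^esub> b) \<in> ?N"
      using submodule_add_left_iff[OF N ideal_combinationsI[OF it(1)] smult_closed[OF yc tM]] c it(4) by simp
    then have "t \<in> ?K" using regular[OF tM] it(2) by (simp add: y_def)
    then show ?thesis using it by blast
  qed
  have "c b \<in> I" if b: "b \<in> B" for b
  proof -
    \<comment> \<open>For fixed \<open>b\<close>, the coefficients of all relations lie in
      \<open>I\<close> plus \<open>y\<close> times this same set, as Nakayama's lemma
      requires.\<close>
    have "(\<lambda>c. c b) ` ?K \<subseteq> I"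
    proof (rule R.nakayama[OF noeth _ insert.prems(2) _ yc])
      show "\<one> \<ominus> r \<otimes> y \<in> Units R" if r: "r \<in> carrier R" for r
      proof (rule unit)
        have ry: "r \<otimes> y \<in> \<mm>" using \<mm>.I_l_closed[OF y\<mm> r] .
        show "\<one> \<ominus> r \<otimes> y \<notin> \<mm>"
        proof
          assume "\<one> \<ominus> r \<otimes> y \<in> \<mm>"
          then have "(\<one> \<ominus> r \<otimes> y) \<oplus> r \<otimes> y \<in> \<mm>" using ry by blast
          then have "\<one> \<in> \<mm>" using r yc by (simp add: R.diff_add_cancel)
          then show False using \<mm>.one_imp_carrier \<mm>.I_notcarr by blast
        qed
      qed (use r yc in simp)
      show "(\<lambda>c. c b) ` ?K \<subseteq> carrier R" using b by blast
      fix a assume "a \<in> (\<lambda>c. c b) ` ?K"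
      then obtain c where c: "c \<in> ?K" "a = c b" by blast
      obtain i t where "i \<in> B \<rightarrow> I" "t \<in> ?K" "\<forall>b\<in>B. c b = i b \<oplus> t b \<otimes> y" using descend[OF c(1)] by blast
      then show "\<exists>i\<in>I. \<exists>t\<in>(\<lambda>c. c b) ` ?K. a = i \<oplus> t \<otimes> y" using b c(2) by blast
    qed
    moreover have "c \<in> ?K" using insert.prems(5,6) by blast
    ultimately show ?thesis by blast
  qed
  then show ?case by blast
qed

text \<open>Subtracting a combination of equal value with coefficients in \<mm> leaves a genuine
  relation \<open>r\<close>. If \<open>c b\<close> were outside \<mm>, then \<open>r b\<close> would
  be a unit and \<open>b\<close> would lie in the span of the other generators.\<close>

lemma minimal_generators_coefficients:
  assumes \<mm>: "ideal \<mm> R" and unit: "\<And>a. a \<in> carrier R \<Longrightarrow> a \<notin> \<mm> \<Longrightarrow> a \<in> Units R"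
    and B: "finite B" "B \<subseteq> carrier M" "module_span R M B = carrier M"
    and minimal: "\<And>A. finite A \<Longrightarrow> A \<subseteq> carrier M \<Longrightarrow> module_span R M A = carrier M \<Longrightarrow> card B \<le> card A"
    and c: "c \<in> B \<rightarrow> carrier R" "(\<Oplus>\<^bsub>M\<^esub>b\<in>B. c b \<odot>\<^bsub>M\<^esub> b) \<in> ideal_combinations B \<mm>"
  shows "c \<in> B \<rightarrow> \<mm>"
proof (rule Pi_I, rule ccontr)
  interpret \<mm>: ideal \<mm> R by fact
  fix b assume b: "b \<in> B" "c b \<notin> \<mm>"
  obtain e where e: "e \<in> B \<rightarrow> \<mm>" "(\<Oplus>\<^bsub>M\<^esub>b\<in>B. c b \<odot>\<^bsub>M\<^esub> b) = (\<Oplus>\<^bsub>M\<^esub>b\<in>B. e b \<odot>\<^bsub>M\<^esub> b)"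
    using c(2) by (elim ideal_combinationsE)
  have eR: "e \<in> B \<rightarrow> carrier R" using e(1) \<mm>.Icarr by blast
  have bM: "b \<in> carrier M" using b B by blast
  define r where "r = (\<lambda>b. c b \<oplus> (\<ominus> \<one>) \<otimes> e b)"
  have r: "r b \<in> carrier R" if "b \<in> B" for b using that c(1) eR by (auto simp: r_def)
  have "r b \<notin> \<mm>"
  proof
    assume "r b \<in> \<mm>"
    then have "r b \<oplus> e b \<in> \<mm>" using e(1) b(1) by blast
    moreover have "r b \<oplus> e b = c b"
    proof -
      have "c b \<in> carrier R" "e b \<in> carrier R" using b(1) c(1) eR by auto
      then show ?thesis unfolding r_def by algebra
    qed
    ultimately show False using b(2) by simp
  qed
  then have u: "r b \<in> Units R" using unit r b(1) by blast
  have cM: "(\<Oplus>\<^bsub>M\<^esub>b\<in>B. c b \<odot>\<^bsub>M\<^esub> b) \<in> carrier M" by (rule combination_closed[OF B(2) c(1)])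
  have "(\<Oplus>\<^bsub>M\<^esub>b\<in>B. r b \<odot>\<^bsub>M\<^esub> b)
      = (\<Oplus>\<^bsub>M\<^esub>b\<in>B. c b \<odot>\<^bsub>M\<^esub> b) \<oplus>\<^bsub>M\<^esub> (\<Oplus>\<^bsub>M\<^esub>b\<in>B. ((\<ominus> \<one>) \<otimes> e b) \<odot>\<^bsub>M\<^esub> b)"
    unfolding r_def using eR by (intro combination_add B c) auto
  also have "\<dots> = (\<Oplus>\<^bsub>M\<^esub>b\<in>B. c b \<odot>\<^bsub>M\<^esub> b) \<oplus>\<^bsub>M\<^esub> (\<ominus> \<one>) \<odot>\<^bsub>M\<^esub> (\<Oplus>\<^bsub>M\<^esub>b\<in>B. c b \<odot>\<^bsub>M\<^esub> b)"
    using combination_smult[OF B(1,2) eR, of "\<ominus> \<one>"] e(2) by simp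
  also have "\<dots> = \<zero>\<^bsub>M\<^esub>" using cM by (simp add: smult_l_minus M.r_neg)
  finally have 0: "(\<Oplus>\<^bsub>M\<^esub>b\<in>B. r b \<odot>\<^bsub>M\<^esub> b) = \<zero>\<^bsub>M\<^esub>" .
  let ?S = "module_span R M (B - {b})"
  have B': "B - {b} \<subseteq> carrier M" using B by auto
  note S = module_span_submodule[OF B']
  define s where "s = (\<Oplus>\<^bsub>M\<^esub>b\<in>B - {b}. r b \<odot>\<^bsub>M\<^esub> b)"
  have s: "s \<in> ?S"
    unfolding s_def using module_span_superset[of "B - {b}"] submoduleE(4)[OF S] r
    by (intro finsum_in_submodule[OF S]) (use B in blast)+
  then have sM: "s \<in> carrier M" using submoduleE(1)[OF S] by blast
  have "(\<Oplus>\<^bsub>M\<^esub>b\<in>insert b (B - {b}). r b \<odot>\<^bsub>M\<^esub> b) = r b \<odot>\<^bsub>M\<^esub> b \<oplus>\<^bsub>M\<^esub> s"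
    unfolding s_def using B r b(1) by (intro M.finsum_insert) auto
  then have "r b \<odot>\<^bsub>M\<^esub> b \<oplus>\<^bsub>M\<^esub> s = \<zero>\<^bsub>M\<^esub>" using 0 b(1) by (simp add: insert_absorb)
  then have "s \<oplus>\<^bsub>M\<^esub> r b \<odot>\<^bsub>M\<^esub> b \<in> ?S" using submodule_zero[OF S] sM bM r[OF b(1)] by (simp add: M.a_comm)
  then have "r b \<odot>\<^bsub>M\<^esub> b \<in> ?S" using submodule_add_left_iff[OF S s] bM r[OF b(1)] by simp
  then have "inv (r b) \<odot>\<^bsub>M\<^esub> (r b \<odot>\<^bsub>M\<^esub> b) \<in> ?S" using submoduleE(4)[OF S] u by blast
  then have "b \<in> ?S" using u bM r[OF b(1)] by (simp add: smult_assoc1[symmetric])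
  then have "B \<subseteq> ?S" using module_span_superset[of "B - {b}"] by blast
  then have "carrier M \<subseteq> ?S" using module_span_minimal[OF S] B(3) by blast
  then have "?S = carrier M" using submoduleE(1)[OF S] by blast
  then have "card B \<le> card (B - {b})" using minimal[of "B - {b}"] B by auto
  then show False using b(1) B(1) card_Diff1_less[of B b] by simp
qed

end

section \<open>Extracting the vanishing of Ext from the depth\<close>

text \<open>If the unit is the only element of the factor group, every coset equals the set of
  coboundaries. This set contains zero, so the coset of a cocycle \<open>f\<close> contains
  \<open>f\<close>.\<close>

lemma cocycles_subset_coboundaries:
  assumes M: "module R M" and F: "\<And>n. module R (F n)" and d: "\<And>n. d n \<in> mod_hom R (F (Suc n)) (F n)"
    and Ext: "carrier (cohomology_group R F d M i) = {\<one>\<^bsub>cohomology_group R F d M i\<^esub>}"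
  shows "cocycles R F d M i \<subseteq> coboundaries R F d M i"
proof
  interpret M: module R M by fact
  let ?H = "coboundaries R F d M i" and ?z = "\<lambda>n. \<lambda>x\<in>carrier (F n). \<zero>\<^bsub>M\<^esub>"
  \<comment> \<open>Zero is a coboundary by definition in degree 0, and as the coboundary of zero in
    higher degrees.\<close>
  have "?z i \<in> ?H"
  proof (cases i)
    case (Suc j)
    interpret Fj: module R "F j" by (rule F)
    have "?z j \<in> mod_hom R (F j) M" by (auto simp: mod_hom_def)
    moreover have "?z i = compose (carrier (F (Suc j))) (?z j) (d j)"
      using Suc d[of j] by (auto simp: compose_def mod_hom_def fun_eq_iff)
    ultimately show ?thesis unfolding Suc coboundaries.simps by blast
  qed (simp add: Hom_group_def)
  fix f assume f: "f \<in> cocycles R F d M i"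
  let ?G = "(Hom_group R (F i) M)\<lparr>carrier := cocycles R F d M i\<rparr>"
  have "?H #>\<^bsub>?G\<^esub> f \<in> carrier (?G Mod ?H)" using f by (auto simp: FactGroup_def RCOSETS_def)
  then have eq: "?H #>\<^bsub>?G\<^esub> f = ?H" using Ext by (simp add: cohomology_group_def FactGroup_def)
  have "?z i \<otimes>\<^bsub>?G\<^esub> f = f"
  proof
    fix x
    have f: "f \<in> mod_hom R (F i) M" using f by (simp add: cocycles_def)
    then have "\<zero>\<^bsub>M\<^esub> \<oplus>\<^bsub>M\<^esub> f x = f x" if "x \<in> carrier (F i)" using M.mod_hom_closed[OF f that] by simp
    with f show "(?z i \<otimes>\<^bsub>?G\<^esub> f) x = f x"
      by (cases "x \<in> carrier (F i)") (auto simp: Hom_group_def mod_hom_def PiE_def extensional_def)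
  qed
  then show "f \<in> ?H" using \<open>?z i \<in> ?H\<close> eq unfolding r_coset_def by blast
qed

text \<open>The induction starts at \<open>N = 0\<close>, where congruence is equality: a cocycle is
  a coboundary and serves as its own witness.\<close>

lemma (in module) cohomology_vanishes_mod_zero:
  assumes F: "\<And>n. module R (F n)" and d: "\<And>n. d n \<in> mod_hom R (F (Suc n)) (F n)"
    and sub: "cocycles R F d M i \<subseteq> coboundaries R F d M i"
  shows "cohomology_vanishes_mod F d {\<zero>\<^bsub>M\<^esub>} i"
  unfolding cohomology_vanishes_mod_def
proof (intro ballI impI)
  fix f assume f: "f \<in> mod_hom R (F i) M" and 0: "\<forall>x\<in>carrier (F (Suc i)). f (d i x) \<in> {\<zero>\<^bsub>M\<^esub>}"
  have "compose (carrier (F (Suc i))) f (d i) = \<one>\<^bsub>Hom_group R (F (Suc i)) M\<^esub>"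
    using 0 by (auto simp: compose_def Hom_group_def fun_eq_iff)
  then have "f \<in> coboundaries R F d M i" using f sub by (auto simp: cocycles_def)
  then show "\<exists>b\<in>coboundaries R F d M i. \<forall>x\<in>carrier (F i). f x \<ominus>\<^bsub>M\<^esub> b x \<in> {\<zero>\<^bsub>M\<^esub>}"
    using mod_hom_closed[OF f] by (intro bexI[of _ f]) (auto simp: a_minus_def M.r_neg)
qed

theorem theorem1p5:
  fixes R :: "('a, 'b) ring_scheme" and M :: "('a, 'm, 'c) module_scheme"
  assumes "regular_local_ring R"
    and "finitely_generated_module R M"
    and "maximal_Cohen_Macaulay R M"
  shows "free_module R M"
proof -
  define \<mm> where "\<mm> = the_maximal_ideal R"
  interpret M: module R M using assms(2) by (simp add: finitely_generated_module_def)
  have noeth: "noetherian_ring R" and loc: "\<exists>!\<mm>. maximalideal \<mm> R"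
    using assms(1) by (auto simp: regular_local_ring_def local_ring_def)
  interpret noetherian_ring R by (rule noeth)
  have \<mm>: "maximalideal \<mm> R" unfolding \<mm>_def the_maximal_ideal_def by (rule theI'[OF loc])
  interpret \<mm>: maximalideal \<mm> R by (rule \<mm>)
  let ?gens = "{enat (card A) | A. finite A \<and> A \<subseteq> carrier R \<and> genideal R A = \<mm>}"
  obtain A0 where "A0 \<subseteq> carrier R" "finite A0" "\<mm> = genideal R A0"
    using finetely_gen[OF \<mm>.is_ideal] by auto
  then have "enat (card A0) \<in> ?gens" by blast
  \<comment> \<open>Finite generation of \<mm> makes the set nonempty, so the infimum is attained
    and is not the default \<infinity>.\<close>
  then have "Inf ?gens \<in> ?gens" unfolding Inf_enat_def by (auto intro: LeastI)
  then obtain X where X: "finite X" "X \<subseteq> carrier R" "genideal R X = \<mm>"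
    and "min_generators R \<mm> = enat (card X)" by (auto simp: min_generators_def)
  then have depth: "depth R M = enat (card X)"
    using assms(1,3) by (simp add: regular_local_ring_def maximal_Cohen_Macaulay_def \<mm>_def)
  have mQ: "module R (quotient_module R \<mm>)"
    by (rule module_quotient_module[OF M.R.is_cring \<mm>.is_ideal])
  obtain F d where Fd: "chosen_resolution R (quotient_module R \<mm>) = (F, d)" by (rule prod.exhaust)
  obtain \<epsilon> where res: "free_resolution R (quotient_module R \<mm>) F d \<epsilon>"
    using chosen_resolution[OF mQ Fd] by auto
  have F: "module R (F n)" and d: "d n \<in> mod_hom R (F (Suc n)) (F n)" for n
    using res by (auto simp: free_resolution_def free_module_def)
  have van: "M.cohomology_vanishes_mod F d {\<zero>\<^bsub>M\<^esub>} i" if i: "i < card X" for i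
  proof (intro M.cohomology_vanishes_mod_zero cocycles_subset_coboundaries M.module_axioms F d)
    let ?E = "Ext_group R (quotient_module R \<mm>) M i"
    have "carrier ?E = {\<one>\<^bsub>?E\<^esub>}"
    proof (rule ccontr)
      assume "carrier ?E \<noteq> {\<one>\<^bsub>?E\<^esub>}"
      then have "depth R M \<le> enat i" unfolding depth_def \<mm>_def by (intro Inf_lower) auto
      then show False using i depth by simp
    qed
    then show "carrier (cohomology_group R F d M i) = {\<one>\<^bsub>cohomology_group R F d M i\<^esub>}"
      by (simp add: Ext_group_def Fd)
  qed
  let ?P = "\<lambda>B. finite B \<and> B \<subseteq> carrier M \<and> module_span R M B = carrier M"
  obtain B0 where "?P B0" using assms(2) by (auto simp: finitely_generated_module_def)
  from ex_has_least_nat[of ?P, OF this, of card] obtain B where B: "finite B" "B \<subseteq> carrier M"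
    "module_span R M B = carrier M" and min: "\<And>A. ?P A \<Longrightarrow> card B \<le> card A" by blast
  have unit: "a \<in> Units R" if "a \<in> carrier R" "a \<notin> \<mm>" for a
    by (rule M.R.Units_avoid_maximal[OF noeth loc \<mm> that])
  have zero: "M.ideal_combinations B {\<zero>\<^bsub>R\<^esub>} = {\<zero>\<^bsub>M\<^esub>}"
  proof -
    have "(\<Oplus>\<^bsub>M\<^esub>b\<in>B. c b \<odot>\<^bsub>M\<^esub> b) = (\<Oplus>\<^bsub>M\<^esub>b\<in>B. \<zero>\<^bsub>M\<^esub>)" if "c \<in> B \<rightarrow> {\<zero>\<^bsub>R\<^esub>}" for c
      using that B(2) by (intro M.M.finsum_cong') (auto simp: Pi_iff subset_iff)
    then have "M.ideal_combinations B {\<zero>\<^bsub>R\<^esub>} \<subseteq> {\<zero>\<^bsub>M\<^esub>}" by (auto elim!: M.ideal_combinationsE)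
    then show ?thesis
      using M.submodule_zero[OF M.ideal_combinations_submodule[OF B(1,2) M.R.zeroideal]] by blast
  qed
  have gen: "genideal R ({\<zero>\<^bsub>R\<^esub>} \<union> X) = \<mm>"
  proof
    show "genideal R ({\<zero>\<^bsub>R\<^esub>} \<union> X) \<subseteq> \<mm>"
      using M.R.genideal_self[OF X(2)] X(3) by (intro M.R.genideal_minimal \<mm>.is_ideal) auto
    have "genideal R X \<subseteq> genideal R ({\<zero>\<^bsub>R\<^esub>} \<union> X)"
      using X(2) by (intro M.R.subset_Idl_subset) auto
    then show "\<mm> \<subseteq> genideal R ({\<zero>\<^bsub>R\<^esub>} \<union> X)" using X(3) by simp
  qed
  have "linearly_independent R M B"
    unfolding linearly_independent_def
  proof (intro allI impI ballI, elim conjE)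
    fix A c b
    assume A: "finite A" "A \<subseteq> B" and c: "c \<in> A \<rightarrow> carrier R" and b: "b \<in> A"
      and 0: "(\<Oplus>\<^bsub>M\<^esub>b\<in>A. c b \<odot>\<^bsub>M\<^esub> b) = \<zero>\<^bsub>M\<^esub>"
    \<comment> \<open>Independence is tested on finite subsets \<open>A\<close>, whereas relations
      are indexed by all of \<open>B\<close>; the missing coefficients are set to zero.\<close>
    let ?c = "\<lambda>b. if b \<in> A then c b else \<zero>\<^bsub>R\<^esub>"
    have "(\<Oplus>\<^bsub>M\<^esub>b\<in>B. ?c b \<odot>\<^bsub>M\<^esub> b) = \<zero>\<^bsub>M\<^esub>"
      using M.finsum_smult_extend[OF B(1) A(2) c, of "\<lambda>b. b"] B(2) 0 by (simp add: Pi_iff subset_iff)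
    then have "(\<Oplus>\<^bsub>M\<^esub>b\<in>B. ?c b \<odot>\<^bsub>M\<^esub> b) \<in> M.ideal_combinations B {\<zero>\<^bsub>R\<^esub>}" using zero by simp
    moreover have "?c \<in> B \<rightarrow> carrier R" using c by auto
    \<comment> \<open>Applied to the zero ideal, with all of \<open>X\<close> still to be exchanged,
      the statement on relations is linear independence.\<close>
    ultimately have "?c \<in> B \<rightarrow> {\<zero>\<^bsub>R\<^esub>}"
      using van min
      by (intro M.relation_coefficients[OF noeth \<mm> unit res B _ X(1,2) M.R.zeroideal gen]
          M.minimal_generators_coefficients[OF \<mm>.is_ideal unit B]) (auto simp: zero)
    then have "?c b \<in> {\<zero>\<^bsub>R\<^esub>}" using b A(2) by blast
    then show "c b = \<zero>\<^bsub>R\<^esub>" using b by simp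
  qed
  then show ?thesis using B M.module_axioms unfolding free_module_def by blast
qed

end
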